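(* Let $n\ge 2$ and $1\le d\le n-1$. There is an isomorphism of $\mathbb C$-algebras $\phi:\Lambda_{d,n}\to\mathbb C[\mathcal V_{d,n}]$ which takes $X_j$ to $x_j$ for $j=1,\dots,d$.
   Context: Put $c=n-d$. The variety $\mathcal V_{d,n}$: Let $B^-\subset GL_n(\mathbb C)$ be the subgroup of invertible lower-triangular matrices and $U^+\subset GL_n(\mathbb C)$ the subgroup of unipotent upper-triangular matrices. Let $e_i$ ($1\le i\le n-1$) be the $n\times n$ matrix with unique nonzero entry $1$ in position $(i,i+1)$, and $e=\sum_{i=1}^{n-1}e_i$. Let $(U^+)^e=\{u\in U^+ : ueu^{-1}=e\}$; it consists exactly of the upper-triangular unipotent Toeplitz matrices $u$ with $(i,j)$ entry $x_{j-i}$ (where $x_0=1$, $x_k=0$ for $k<0$), so that $\mathbb C[(U^+)^e]=\mathbb C[x_1,\dots,x_{n-1}]$. Let $W\subset GL_n(\mathbb C)$ be the group of permutation matrices, $s_k\in W$ the adjacent transposition $(k,k+1)$, $w_0\in W$ the longest element (the order-reversing permutation). For $K\subset\{1,\dots,n-1\}$ let $w_K$ be the longest element of the subgroup $W_K=\langle s_k : k\in K\rangle$ and $w^K=w_0w_K$. Let $\{\hat d\}=\{1,\dots,n-1\}\setminus\{d\}$. Then $$\mathcal V_{d,n}:=(U^+)^e\cap\overline{B^-w^{\{\hat d\}}B^-},$$ a closed subvariety of $GL_n(\mathbb C)$ (closure in $GL_n(\mathbb C)$), and $\mathbb C[\mathcal V_{d,n}]$ denotes its coordinate ring as a reduced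 affine algebraic variety. The restrictions to $\mathcal V_{d,n}$ of the coordinate functions $x_j$ are again denoted $x_j$. The ring $\Lambda_{d,n}$: For $k=1,\dots,n$ let $Y_k=\det(X_{i-j+1})_{i,j=1,\dots,k}\in\mathbb Z[X_1,\dots,X_d]$, where $X_0:=1$ and $X_k:=0$ if $k\notin\{0,\dots,d\}$. Then $$\Lambda_{d,n}:=\mathbb C[X_1,\dots,X_d]/(Y_{c+1},\dots,Y_{n-1}).$$ *)

theory Defs
  imports
    "HOL-Algebra.QuotRing"
    "HOL-Algebra.Generated_Groups"
    "HOL-Library.FuncSet"
    "HOL-Library.Poly_Mapping"
    "HOL-Combinatorics.Permutations"
    "Jordan_Normal_Form.Determinant"
begin

text \<open>Matrix rows and columns are numbered from 0 below, so that the entry in position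
  (i, j) of the usual numbering is at index (i - 1, j - 1). The indices k of the simple
  reflections run over {1..n-1} as usual.\<close>

definition GL :: "nat \<Rightarrow> complex mat monoid" where
  "GL n = units_of (ring_mat TYPE(complex) n ())"

definition lower_borel :: "nat \<Rightarrow> complex mat set" where
  "lower_borel n = {A \<in> carrier (GL n). \<forall>i<n. \<forall>j<n. i < j \<longrightarrow> A $$ (i, j) = 0}"

definition upper_unipotent :: "nat \<Rightarrow> complex mat set" where
  "upper_unipotent n =
    {A \<in> carrier (GL n).
      (\<forall>i<n. \<forall>j<i. A $$ (i, j) = 0) \<and> (\<forall>i<n. A $$ (i, i) = 1)}"

definition principal_nilpotent :: "nat \<Rightarrow> complex mat" where
  "principal_nilpotent n = mat n n (\<lambda>(i, j). if j = i + 1 then 1 else 0)"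

definition upper_unipotent_centralizer :: "nat \<Rightarrow> complex mat set" where
  "upper_unipotent_centralizer n =
    {u \<in> upper_unipotent n.
      u * principal_nilpotent n * inv\<^bsub>GL n\<^esub> u = principal_nilpotent n}"

definition perm_mat :: "nat \<Rightarrow> (nat \<Rightarrow> nat) \<Rightarrow> complex mat" where
  "perm_mat n \<pi> = mat n n (\<lambda>(i, j). if i = \<pi> j then 1 else 0)"

definition weyl_group :: "nat \<Rightarrow> complex mat set" where
  "weyl_group n = {perm_mat n \<pi> |\<pi>. \<pi> permutes {0..<n}}"

definition simple_reflection :: "nat \<Rightarrow> nat \<Rightarrow> complex mat" where
  "simple_reflection n k = perm_mat n (Transposition.transpose (k - 1) k)"

definition weyl_length :: "nat \<Rightarrow> complex mat \<Rightarrow> nat" where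
  "weyl_length n w =
    (LEAST l. \<exists>ks. set ks \<subseteq> {1..n - 1} \<and> length ks = l \<and>
      w = foldr (\<lambda>k A. simple_reflection n k * A) ks (1\<^sub>m n))"

definition longest_element :: "nat \<Rightarrow> complex mat set \<Rightarrow> complex mat" where
  "longest_element n S =
    (THE w. w \<in> S \<and> (\<forall>v\<in>S. v \<noteq> w \<longrightarrow> weyl_length n v < weyl_length n w))"

definition parabolic_subgroup :: "nat \<Rightarrow> nat set \<Rightarrow> complex mat set" where
  "parabolic_subgroup n K = generate (GL n) (simple_reflection n ` K)"

definition w_upper :: "nat \<Rightarrow> nat set \<Rightarrow> complex mat" where
  "w_upper n K =
    longest_element n (weyl_group n) * longest_element n (parabolic_subgroup n K)"

definition double_coset :: "nat \<Rightarrow> complex mat \<Rightarrow> complex mat set" where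
  "double_coset n w = {a * w * b |a b. a \<in> lower_borel n \<and> b \<in> lower_borel n}"

text \<open>The regular functions on the affine variety of invertible matrices: the algebra
  generated by the matrix entries and the inverse of the determinant. Values outside the
  invertible matrices are irrelevant.\<close>

inductive_set regular_functions :: "nat \<Rightarrow> (complex mat \<Rightarrow> complex) set" for n :: nat where
  reg_const: "(\<lambda>_. a) \<in> regular_functions n"
| reg_entry: "i < n \<Longrightarrow> j < n \<Longrightarrow> (\<lambda>A. A $$ (i, j)) \<in> regular_functions n"
| reg_inv_det: "(\<lambda>A. inverse (det A)) \<in> regular_functions n"
| reg_add: "f \<in> regular_functions n \<Longrightarrow> g \<in> regular_functions n \<Longrightarrow>
    (\<lambda>A. f A + g A) \<in> regular_functions n"
| reg_mult: "f \<in> regular_functions n \<Longrightarrow> g \<in> regular_functions n \<Longrightarrow>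
    (\<lambda>A. f A * g A) \<in> regular_functions n"

definition zariski_closed :: "nat \<Rightarrow> complex mat set \<Rightarrow> bool" where
  "zariski_closed n Z \<longleftrightarrow>
    (\<exists>F \<subseteq> regular_functions n. Z = {A \<in> carrier (GL n). \<forall>f\<in>F. f A = 0})"

definition zariski_closure :: "nat \<Rightarrow> complex mat set \<Rightarrow> complex mat set" where
  "zariski_closure n S = \<Inter>{Z. zariski_closed n Z \<and> S \<subseteq> Z}"

text \<open>The coordinate ring of a closed subvariety V, as the ring of functions on V that are
  restrictions of regular functions on the ambient group.\<close>

definition coordinate_ring ::
    "nat \<Rightarrow> complex mat set \<Rightarrow> (complex mat \<Rightarrow> complex) ring" where
  "coordinate_ring n V =
    \<lparr>carrier = {restrict f V |f. f \<in> regular_functions n},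
     monoid.mult = (\<lambda>f g. \<lambda>A\<in>V. f A * g A),
     one = (\<lambda>A\<in>V. 1),
     zero = (\<lambda>A\<in>V. 0),
     add = (\<lambda>f g. \<lambda>A\<in>V. f A + g A)\<rparr>"

definition peterson_variety :: "nat \<Rightarrow> nat \<Rightarrow> complex mat set" where
  "peterson_variety d n =
    upper_unipotent_centralizer n \<inter>
    zariski_closure n (double_coset n (w_upper n ({1..n - 1} - {d})))"

text \<open>On Toeplitz matrices, x_j is the entry in the first row, j places right of the
  diagonal.\<close>

definition toeplitz_coord :: "nat \<Rightarrow> complex mat \<Rightarrow> complex" where
  "toeplitz_coord j u = u $$ (0, j)"

text \<open>Polynomials in variables indexed by natural numbers are finitely supported functions
  from monomials, themselves finitely supported exponent vectors, to coefficients.\<close>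

type_synonym cpoly = "(nat \<Rightarrow>\<^sub>0 nat) \<Rightarrow>\<^sub>0 complex"

definition poly_const :: "complex \<Rightarrow> cpoly" where
  "poly_const a = Poly_Mapping.single 0 a"

definition poly_var :: "nat \<Rightarrow> cpoly" where
  "poly_var j = Poly_Mapping.single (Poly_Mapping.single j 1) 1"

definition polynomial_ring :: "nat \<Rightarrow> cpoly ring" where
  "polynomial_ring d =
    \<lparr>carrier = {p. \<forall>m \<in> Poly_Mapping.keys p. Poly_Mapping.keys m \<subseteq> {1..d}},
     monoid.mult = (*), one = 1, zero = 0, add = (+)\<rparr>"

definition X_ext :: "nat \<Rightarrow> int \<Rightarrow> cpoly" where
  "X_ext d k = (if k = 0 then 1 else if 1 \<le> k \<and> k \<le> int d then poly_var (nat k) else 0)"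

definition Y_poly :: "nat \<Rightarrow> nat \<Rightarrow> cpoly" where
  "Y_poly d k = det (mat k k (\<lambda>(i, j). X_ext d (int i - int j + 1)))"

definition Lambda_ideal :: "nat \<Rightarrow> nat \<Rightarrow> cpoly set" where
  "Lambda_ideal d n =
    Idl\<^bsub>polynomial_ring d\<^esub> (Y_poly d ` {n - d + 1..n - 1})"

definition Lambda :: "nat \<Rightarrow> nat \<Rightarrow> cpoly set ring" where
  "Lambda d n = polynomial_ring d Quot Lambda_ideal d n"

definition Lambda_class :: "nat \<Rightarrow> nat \<Rightarrow> cpoly \<Rightarrow> cpoly set" where
  "Lambda_class d n p = Lambda_ideal d n +>\<^bsub>polynomial_ring d\<^esub> p"

end

theory Submission
  imports Defs
begin

text \<open>Write c = n - d. On Toeplitz matrices u(x), the closure of the double coset is cut out by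
  band conditions on u(x) and on its inverse: x_k = 0 for k > d, and the coefficients of the inverse
  power series, which are the Y_k up to sign, vanish for c < k < n. Conversely such a u(x) with
  nonzero x_d and Y_c is explicitly in the double coset, and otherwise it is the identity, a limit
  of points of the first kind. So V is the zero locus of Y_{c+1}, ..., Y_{n-1}, and what remains is
  that these polynomials generate a radical ideal. Induction on d and c, splitting off multiples
  of X_d, shows that Lambda is spanned over C[Y_n] by the binomial(n, d) monomials with at most c
  factors. The fibre of Y_n over any nonzero value contains binomial(n, d) points, one for each choice
  of d of the n-th roots of a nonzero number. Since polynomials separate these points, the monomials
  are independent on the fibre, so a C[Y_n]-combination of them that vanishes on V is zero.\<close>

section \<open>Polynomials and weighted degree\<close>

text \<open>Radicality cannot be tested at every value of Y_n: over 0 the fibre is the graded ring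
  Lambda/(Y_n), which has nilpotents. Coefficients in C[Y_n] get around this, because a polynomial
  in one variable is zero once it vanishes at all nonzero values. The weights, i for X_i, turn a
  C-span modulo Y_{c+1}, ..., Y_n into a C[Y_n]-span modulo Y_{c+1}, ..., Y_{n-1}: the cofactor of
  Y_n has weight smaller by n, so the rewriting stops. The roots come from power series. Let U be
  the set of n-th roots of a, and S a subset with d elements. The product of 1 - z t over z in S,
  times the same product over U - S, is 1 - a t^n. So the inverse of the first factor is the second
  one times 1 + a t^n + ...; its coefficients strictly between c and n vanish and the n-th is a. The
  proof works with the coefficients of the inverse series, which differ from the Y_k by the sign
  (-1)^k.\<close>

definition monom_eval :: "(nat \<Rightarrow> complex) \<Rightarrow> (nat \<Rightarrow>\<^sub>0 nat) \<Rightarrow> complex" where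
  "monom_eval x m = (\<Prod>i\<in>Poly_Mapping.keys m. x i ^ Poly_Mapping.lookup m i)"

definition cpoly_eval :: "(nat \<Rightarrow> complex) \<Rightarrow> cpoly \<Rightarrow> complex" where
  "cpoly_eval x p = (\<Sum>m\<in>Poly_Mapping.keys p. Poly_Mapping.lookup p m * monom_eval x m)"

lemma monom_eval_superset:
  "finite S \<Longrightarrow> Poly_Mapping.keys m \<subseteq> S \<Longrightarrow>
    monom_eval x m = (\<Prod>i\<in>S. x i ^ Poly_Mapping.lookup m i)"
  unfolding monom_eval_def
  by (rule prod.mono_neutral_left) (auto simp: in_keys_iff)

lemma monom_eval_add: "monom_eval x (m + m') = monom_eval x m * monom_eval x m'"
proof -
  let ?S = "Poly_Mapping.keys m \<union> Poly_Mapping.keys m'"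
  have "monom_eval x (m + m') = (\<Prod>i\<in>?S. x i ^ Poly_Mapping.lookup (m + m') i)"
    by (rule monom_eval_superset) (use keys_add[of m m'] in auto)
  moreover have "monom_eval x m = (\<Prod>i\<in>?S. x i ^ Poly_Mapping.lookup m i)"
    by (rule monom_eval_superset) auto
  moreover have "monom_eval x m' = (\<Prod>i\<in>?S. x i ^ Poly_Mapping.lookup m' i)"
    by (rule monom_eval_superset) auto
  ultimately show ?thesis
    by (simp add: lookup_add power_add prod.distrib)
qed

lemma cpoly_eval_superset:
  "finite S \<Longrightarrow> Poly_Mapping.keys p \<subseteq> S \<Longrightarrow>
    cpoly_eval x p = (\<Sum>m\<in>S. Poly_Mapping.lookup p m * monom_eval x m)"
  unfolding cpoly_eval_def
  by (rule sum.mono_neutral_left) (auto simp: in_keys_iff)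

lemma cpoly_eval_add [simp]: "cpoly_eval x (p + q) = cpoly_eval x p + cpoly_eval x q"
proof -
  let ?S = "Poly_Mapping.keys p \<union> Poly_Mapping.keys q"
  have "cpoly_eval x (p + q) = (\<Sum>i\<in>?S. Poly_Mapping.lookup (p + q) i * monom_eval x i)"
    by (rule cpoly_eval_superset) (use keys_add[of p q] in auto)
  moreover have "cpoly_eval x p = (\<Sum>i\<in>?S. Poly_Mapping.lookup p i * monom_eval x i)"
    by (rule cpoly_eval_superset) auto
  moreover have "cpoly_eval x q = (\<Sum>i\<in>?S. Poly_Mapping.lookup q i * monom_eval x i)"
    by (rule cpoly_eval_superset) auto
  ultimately show ?thesis
    by (simp add: lookup_add distrib_right sum.distrib)
qed

lemma cpoly_eval_single: "cpoly_eval x (Poly_Mapping.single m a) = a * monom_eval x m"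
  by (auto simp: cpoly_eval_def)

lemma cpoly_eval_0 [simp]: "cpoly_eval x 0 = 0"
  by (simp add: cpoly_eval_def)

lemma cpoly_eval_const [simp]: "cpoly_eval x (poly_const a) = a"
  by (simp add: poly_const_def cpoly_eval_single monom_eval_def)

lemma cpoly_eval_1 [simp]: "cpoly_eval x 1 = 1"
  using cpoly_eval_const[of x 1] by (simp add: poly_const_def)

lemma cpoly_eval_var [simp]: "cpoly_eval x (poly_var i) = x i"
  by (simp add: poly_var_def cpoly_eval_single monom_eval_def)

lemma cpoly_single_induct [case_names zero single add]:
  assumes "P 0" "\<And>m a. P (Poly_Mapping.single m a)" "\<And>p q. P p \<Longrightarrow> P q \<Longrightarrow> P (p + q)"
  shows "P (p :: 'a \<Rightarrow>\<^sub>0 'b::comm_monoid_add)"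
proof (induction p rule: update_induct)
  case const
  then show ?case by fact
next
  case (update f a b)
  have "Poly_Mapping.update a b f = f + Poly_Mapping.single a b"
    using update(1) by (intro poly_mapping_eqI)
      (auto simp: lookup_update lookup_add lookup_single in_keys_iff)
  then show ?case using assms update by simp
qed

lemma cpoly_eval_mult [simp]: "cpoly_eval x (p * q) = cpoly_eval x p * cpoly_eval x q"
proof (induction p rule: cpoly_single_induct)
  case (single m a)
  show ?case
    by (induction q rule: cpoly_single_induct)
      (simp_all add: mult_single cpoly_eval_single monom_eval_add distrib_left)
qed (simp_all add: distrib_right)

lemma cpoly_eval_uminus [simp]: "cpoly_eval x (- p) = - cpoly_eval x p"
  using cpoly_eval_add[of x p "- p"] by (simp add: eq_neg_iff_add_eq_0 add.commute del: cpoly_eval_add)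

lemma cpoly_eval_diff [simp]: "cpoly_eval x (p - q) = cpoly_eval x p - cpoly_eval x q"
  using cpoly_eval_add[of x p "- q"] by (simp del: cpoly_eval_add)

lemma cpoly_eval_sum [simp]: "cpoly_eval x (\<Sum>i\<in>I. f i) = (\<Sum>i\<in>I. cpoly_eval x (f i))"
  by (induction I rule: infinite_finite_induct) auto

lemma cpoly_eval_prod [simp]: "cpoly_eval x (\<Prod>i\<in>I. f i) = (\<Prod>i\<in>I. cpoly_eval x (f i))"
  by (induction I rule: infinite_finite_induct) auto

lemma poly_const_0 [simp]: "poly_const 0 = 0"
  and poly_const_1 [simp]: "poly_const 1 = 1"
  by (simp_all add: poly_const_def)

lemma poly_const_add: "poly_const (a + b) = poly_const a + poly_const b"
  by (simp add: poly_const_def single_add)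

lemma poly_const_mult: "poly_const (a * b) = poly_const a * poly_const b"
  by (simp add: poly_const_def mult_single)

lemma poly_const_uminus: "poly_const (- a) = - poly_const a"
  by (simp add: poly_const_def single_uminus)

section \<open>Weighted degree\<close>

text \<open>The i-th variable has weight i. The bound is an integer so that for negative m only 0 is
  left.\<close>

inductive wdeg_bound :: "nat \<Rightarrow> int \<Rightarrow> cpoly \<Rightarrow> bool" for d :: nat where
  "wdeg_bound d m 0"
| "0 \<le> m \<Longrightarrow> wdeg_bound d m (poly_const a)"
| "1 \<le> i \<Longrightarrow> i \<le> d \<Longrightarrow> wdeg_bound d (m - int i) p \<Longrightarrow> wdeg_bound d m (poly_var i * p)"
| "wdeg_bound d m p \<Longrightarrow> wdeg_bound d m q \<Longrightarrow> wdeg_bound d m (p + q)"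

definition wdeg_le :: "nat \<Rightarrow> int \<Rightarrow> cpoly set" where
  "wdeg_le d m = Collect (wdeg_bound d m)"

lemma wdeg_le_zero: "0 \<in> wdeg_le d m"
  and wdeg_le_const: "0 \<le> m \<Longrightarrow> poly_const a \<in> wdeg_le d m"
  and wdeg_le_var:
    "1 \<le> i \<Longrightarrow> i \<le> d \<Longrightarrow> p \<in> wdeg_le d (m - int i) \<Longrightarrow> poly_var i * p \<in> wdeg_le d m"
  and wdeg_le_add: "p \<in> wdeg_le d m \<Longrightarrow> q \<in> wdeg_le d m \<Longrightarrow> p + q \<in> wdeg_le d m"
  unfolding wdeg_le_def by (simp_all add: wdeg_bound.intros)

lemmas wdeg_le_intros = wdeg_le_zero wdeg_le_const wdeg_le_var wdeg_le_add

lemma wdeg_le_induct [consumes 1, case_names zero const var add]: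
  assumes "p \<in> wdeg_le d m"
    and "\<And>m. P m 0"
    and "\<And>m a. 0 \<le> m \<Longrightarrow> P m (poly_const a)"
    and "\<And>i p m. 1 \<le> i \<Longrightarrow> i \<le> d \<Longrightarrow> p \<in> wdeg_le d (m - int i) \<Longrightarrow> P (m - int i) p \<Longrightarrow>
      P m (poly_var i * p)"
    and "\<And>p m q. p \<in> wdeg_le d m \<Longrightarrow> P m p \<Longrightarrow> q \<in> wdeg_le d m \<Longrightarrow> P m q \<Longrightarrow> P m (p + q)"
  shows "P m p"
proof -
  have "wdeg_bound d m p" using assms(1) by (simp add: wdeg_le_def)
  then show ?thesis
    by (induction rule: wdeg_bound.induct) (use assms(2-5) in \<open>auto simp: wdeg_le_def\<close>)
qed

text \<open>This ends the descent on the cofactor of \<open>inv_poly d (d + c)\<close> in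
  \<open>spanning_mod_ideal\<close>.\<close>

lemma wdeg_le_negative: "p \<in> wdeg_le d m \<Longrightarrow> m < 0 \<Longrightarrow> p = 0"
  by (induction rule: wdeg_le_induct) auto

lemma wdeg_le_mono: "p \<in> wdeg_le d m \<Longrightarrow> m \<le> m' \<Longrightarrow> d \<le> d' \<Longrightarrow> p \<in> wdeg_le d' m'"
proof (induction arbitrary: m' rule: wdeg_le_induct)
  case (var i p m)
  show ?case
    by (rule wdeg_le_var) (use var in auto)
qed (auto intro: wdeg_le_intros)

lemma wdeg_le_mult:
  "p \<in> wdeg_le d m \<Longrightarrow> q \<in> wdeg_le d m' \<Longrightarrow> p * q \<in> wdeg_le d (m + m')"
proof (induction rule: wdeg_le_induct)
  case (const m a)
  from const(2) have "poly_const a * q \<in> wdeg_le d m'"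
  proof (induction rule: wdeg_le_induct)
    case (var i p m)
    then show ?case
      using wdeg_le_var[of i d "poly_const a * p" m] by (simp add: mult.left_commute)
  qed (auto intro: wdeg_le_intros simp: distrib_left poly_const_mult[symmetric])
  then show ?case
    by (rule wdeg_le_mono) (use const in auto)
next
  case (var i p m)
  then show ?case
    using wdeg_le_var[of i d "p * q" "m + m'"] by (simp add: mult.assoc algebra_simps)
qed (auto intro: wdeg_le_intros simp: distrib_right)

lemma wdeg_le_uminus: "p \<in> wdeg_le d m \<Longrightarrow> - p \<in> wdeg_le d m"
  using wdeg_le_mult[OF wdeg_le_const[of 0 "-1" d], of p m] by (simp add: poly_const_uminus)

lemma wdeg_le_sum: "(\<And>i. i \<in> I \<Longrightarrow> f i \<in> wdeg_le d m) \<Longrightarrow> (\<Sum>i\<in>I. f i) \<in> wdeg_le d m"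
  by (induction I rule: infinite_finite_induct) (auto intro: wdeg_le_intros)

lemma wdeg_le_var_mult:
  assumes "p \<in> wdeg_le d m" "1 \<le> i" "i \<le> d" "m + int i \<le> m'"
  shows "poly_var i * p \<in> wdeg_le d m'"
  by (rule wdeg_le_var[OF assms(2,3)]) (use assms wdeg_le_mono in auto)

text \<open>Division by the last variable within the weight bounds; the remainder involves only the
  earlier variables.\<close>

lemma wdeg_le_split:
  "p \<in> wdeg_le (Suc d) m \<Longrightarrow>
    \<exists>q r. q \<in> wdeg_le d m \<and> r \<in> wdeg_le (Suc d) (m - int (Suc d)) \<and> p = q + poly_var (Suc d) * r"
proof (induction rule: wdeg_le_induct)
  case (zero m)
  show ?case by (rule exI[of _ 0], rule exI[of _ 0]) (auto intro: wdeg_le_intros)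
next
  case (const m a)
  then show ?case by (intro exI[of _ "poly_const a"] exI[of _ 0]) (auto intro: wdeg_le_intros)
next
  case (add p m q)
  then obtain q1 r1 q2 r2 where
    "q1 \<in> wdeg_le d m" "r1 \<in> wdeg_le (Suc d) (m - int (Suc d))" "p = q1 + poly_var (Suc d) * r1"
    "q2 \<in> wdeg_le d m" "r2 \<in> wdeg_le (Suc d) (m - int (Suc d))" "q = q2 + poly_var (Suc d) * r2"
    by blast
  then show ?case
    by (intro exI[of _ "q1 + q2"] exI[of _ "r1 + r2"])
      (auto intro: wdeg_le_add simp: algebra_simps)
next
  case (var i p m)
  show ?case
  proof (cases "i = Suc d")
    case True
    then show ?thesis
      using var by (intro exI[of _ 0] exI[of _ p]) (auto intro: wdeg_le_intros)
  next
    case False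
    with var have i: "1 \<le> i" "i \<le> d" by auto
    from var obtain q r where qr: "q \<in> wdeg_le d (m - int i)"
      "r \<in> wdeg_le (Suc d) (m - int i - int (Suc d))" "p = q + poly_var (Suc d) * r"
      by blast
    have "poly_var i * q \<in> wdeg_le d m" by (rule wdeg_le_var[OF i qr(1)])
    moreover have "poly_var i * r \<in> wdeg_le (Suc d) (m - int (Suc d))"
      by (rule wdeg_le_var_mult[OF qr(2)]) (use i in auto)
    ultimately show ?thesis
      using qr(3) by (intro exI[of _ "poly_var i * q"] exI[of _ "poly_var i * r"])
        (auto simp: algebra_simps)
  qed
qed

section \<open>Coefficients of the inverse power series\<close>

text \<open>Coefficients of the inverse of the power series with constant term 1 and higher
  coefficients x; the value of x at 0 is not inspected.\<close>

fun inv_series :: "(nat \<Rightarrow> 'a::comm_ring_1) \<Rightarrow> nat \<Rightarrow> 'a" where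
  "inv_series x k = (if k = 0 then 1 else - (\<Sum>i\<in>{1..k}. x i * inv_series x (k - i)))"

declare inv_series.simps [simp del]

lemma inv_series_0 [simp]: "inv_series x 0 = 1"
  by (simp add: inv_series.simps)

lemma inv_series_convolution:
  assumes "x 0 = 1" "k > 0"
  shows "(\<Sum>i\<le>k. x i * inv_series x (k - i)) = 0"
proof -
  have "{..k} = insert 0 {1..k}" by auto
  then have "(\<Sum>i\<le>k. x i * inv_series x (k - i)) =
      x 0 * inv_series x (k - 0) + (\<Sum>i\<in>{1..k}. x i * inv_series x (k - i))"
    by simp
  then show ?thesis
    using assms inv_series.simps[of x k] by simp
qed

text \<open>Generic in the ring, so that one recursion yields both the polynomials
  \<open>inv_poly\<close> and, through \<open>cpoly_eval_inv_poly\<close>, their values at a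
  point.\<close>

definition trunc_seq :: "nat \<Rightarrow> (nat \<Rightarrow> 'a::comm_ring_1) \<Rightarrow> nat \<Rightarrow> 'a" where
  "trunc_seq d x i = (if i = 0 then 1 else if i \<le> d then x i else 0)"

abbreviation inv_poly :: "nat \<Rightarrow> nat \<Rightarrow> cpoly" where
  "inv_poly d k \<equiv> inv_series (trunc_seq d poly_var) k"

lemma trunc_seq_0 [simp]: "trunc_seq d x 0 = 1"
  by (simp add: trunc_seq_def)

lemma cpoly_eval_inv_poly [simp]:
  "cpoly_eval x (inv_poly d k) = inv_series (trunc_seq d x) k"
proof (induction k rule: less_induct)
  case (less k)
  have "cpoly_eval x (trunc_seq d poly_var i) = trunc_seq d x i" for i
    by (simp add: trunc_seq_def)
  then show ?case
    using less by (cases "k = 0") (simp_all add: inv_series.simps[of _ k])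
qed

lemma trunc_seq_wdeg: "p \<in> wdeg_le d (m - int i) \<Longrightarrow> trunc_seq d poly_var i * p \<in> wdeg_le d m"
  by (auto simp: trunc_seq_def intro: wdeg_le_intros)

lemma inv_poly_wdeg: "inv_poly d k \<in> wdeg_le d (int k)"
proof (induction k rule: less_induct)
  case (less k)
  show ?case
  proof (cases "k = 0")
    case True
    then show ?thesis using wdeg_le_const[of 0 1 d] by simp
  next
    case False
    have "trunc_seq d poly_var i * inv_poly d (k - i) \<in> wdeg_le d (int k)" if "i \<in> {1..k}" for i
      by (rule trunc_seq_wdeg) (use less[of "k - i"] that in \<open>auto simp: of_nat_diff\<close>)
    then show ?thesis
      using False by (subst inv_series.simps) (auto intro!: wdeg_le_uminus wdeg_le_sum)
  qed
qed

text \<open>Setting the new variable to 0 turns \<open>inv_poly (Suc d) k\<close> into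
  \<open>inv_poly d k\<close>. The weight of the quotient is recorded because the cofactors in
  \<open>rel_span\<close> are bounded by weight.\<close>

lemma inv_poly_Suc:
  "\<exists>s\<in>wdeg_le (Suc d) (int k - int (Suc d)). inv_poly d k = inv_poly (Suc d) k + poly_var (Suc d) * s"
proof (induction k rule: less_induct)
  case (less k)
  show ?case
  proof (cases "k = 0")
    case True
    then show ?thesis by (intro bexI[of _ 0]) (auto intro: wdeg_le_intros)
  next
    case False
    let ?D = "Suc d"
    from less have "\<forall>j. \<exists>s. j < k \<longrightarrow> s \<in> wdeg_le ?D (int j - int ?D) \<and>
      inv_poly d j = inv_poly ?D j + poly_var ?D * s" by blast
    then obtain s where s: "\<And>j. j < k \<Longrightarrow> s j \<in> wdeg_le ?D (int j - int ?D)"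
      "\<And>j. j < k \<Longrightarrow> inv_poly d j = inv_poly ?D j + poly_var ?D * s j" by metis
    \<comment> \<open>At i = Suc d the shorter sequence contributes 0 and the longer one a whole
      product, which the correction has to cancel; at other indices it is inherited from k -
      i.\<close>
    define t where "t i = (if i = ?D then - inv_poly ?D (k - i) else trunc_seq d poly_var i * s (k - i))" for i
    have t: "trunc_seq d poly_var i * inv_poly d (k - i) =
        trunc_seq ?D poly_var i * inv_poly ?D (k - i) + poly_var ?D * t i" if "i \<in> {1..k}" for i
      using that s(2)[of "k - i"] by (auto simp: trunc_seq_def t_def algebra_simps)
    have "t i \<in> wdeg_le ?D (int k - int ?D)" if "i \<in> {1..k}" for i
    proof (cases "i = ?D")
      case True
      then show ?thesis
        using inv_poly_wdeg[of ?D "k - i"] that by (auto simp: t_def of_nat_diff intro!: wdeg_le_uminus)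
    next
      case False
      have "trunc_seq ?D poly_var i * s (k - i) \<in> wdeg_le ?D (int k - int ?D)"
        by (rule trunc_seq_wdeg) (use s(1)[of "k - i"] that in \<open>auto simp: of_nat_diff algebra_simps\<close>)
      moreover have "trunc_seq d poly_var i * s (k - i) = 0 \<or>
        trunc_seq d poly_var i = trunc_seq ?D poly_var i"
        using False by (auto simp: trunc_seq_def)
      ultimately show ?thesis
        using False wdeg_le_zero[of ?D] by (auto simp: t_def)
    qed
    then have "- (\<Sum>i\<in>{1..k}. t i) \<in> wdeg_le ?D (int k - int ?D)"
      by (intro wdeg_le_uminus wdeg_le_sum)
    moreover have "inv_poly d k = inv_poly ?D k + poly_var ?D * - (\<Sum>i\<in>{1..k}. t i)"
      using False t by (simp add: inv_series.simps[of _ k] sum.distrib sum_distrib_left)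
    ultimately show ?thesis by blast
  qed
qed

section \<open>Spanning by monomials modulo the relations\<close>

text \<open>The monomials in the first d variables with at most c factors.\<close>

fun monomials :: "nat \<Rightarrow> nat \<Rightarrow> cpoly list" where
  "monomials 0 c = [1]"
| "monomials (Suc d) 0 = [1]"
| "monomials (Suc d) (Suc c) =
    monomials d (Suc c) @ map ((*) (poly_var (Suc d))) (monomials (Suc d) c)"

text \<open>The recursion of \<open>monomials\<close> is Pascal's rule.\<close>

lemma length_monomials: "length (monomials d c) = (d + c) choose d"
  by (induction d c rule: monomials.induct) auto

text \<open>The range of k includes c + d, so constant coefficients suffice for the monomials. The
  bound m restricts the cofactors g only, and lets multiples of \<open>inv_poly d (d + c)\<close> be
  rewritten further later on.\<close>

inductive_set rel_span :: "nat \<Rightarrow> nat \<Rightarrow> int \<Rightarrow> cpoly set" for d c :: nat and m :: int where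
  zero: "0 \<in> rel_span d c m"
| mon: "b \<in> set (monomials d c) \<Longrightarrow> poly_const a * b \<in> rel_span d c m"
| rel: "c < k \<Longrightarrow> k \<le> c + d \<Longrightarrow> g \<in> wdeg_le d (m - int k) \<Longrightarrow> g * inv_poly d k \<in> rel_span d c m"
| add: "p \<in> rel_span d c m \<Longrightarrow> q \<in> rel_span d c m \<Longrightarrow> p + q \<in> rel_span d c m"

lemma rel_span_sum: "(\<And>i. i \<in> I \<Longrightarrow> f i \<in> rel_span d c m) \<Longrightarrow> (\<Sum>i\<in>I. f i) \<in> rel_span d c m"
  by (induction I rule: infinite_finite_induct) (auto intro: rel_span.intros)

text \<open>By \<open>inv_poly_Suc\<close>, passing from relations in d variables to those in d + 1
  variables costs a multiple of the new variable, which is treated separately.\<close>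

lemma rel_span_restrict:
  "p \<in> rel_span d (Suc c) m \<Longrightarrow>
    \<exists>q r. q \<in> rel_span (Suc d) (Suc c) m \<and> r \<in> wdeg_le (Suc d) (m - int (Suc d)) \<and>
      p = q + poly_var (Suc d) * r"
proof (induction rule: rel_span.induct)
  case zero
  show ?case by (intro exI[of _ 0]) (auto intro: rel_span.intros wdeg_le_intros)
next
  case (mon b a)
  then have "poly_const a * b \<in> rel_span (Suc d) (Suc c) m"
    by (intro rel_span.mon) auto
  then show ?case by (intro exI[of _ "poly_const a * b"] exI[of _ 0]) (auto intro: wdeg_le_intros)
next
  case (rel k g)
  obtain s where s: "s \<in> wdeg_le (Suc d) (int k - int (Suc d))"
    "inv_poly d k = inv_poly (Suc d) k + poly_var (Suc d) * s"
    using inv_poly_Suc by blast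
  have g: "g \<in> wdeg_le (Suc d) (m - int k)"
    using rel(3) by (rule wdeg_le_mono) auto
  have "g * s \<in> wdeg_le (Suc d) (m - int (Suc d))"
    using wdeg_le_mult[OF g s(1)] by (simp add: algebra_simps)
  moreover have "g * inv_poly (Suc d) k \<in> rel_span (Suc d) (Suc c) m"
    by (rule rel_span.rel) (use rel g in auto)
  ultimately show ?case
    using s(2) by (intro exI[of _ "g * inv_poly (Suc d) k"] exI[of _ "g * s"])
      (auto simp: algebra_simps)
next
  case (add p q)
  then obtain q1 r1 q2 r2 where
    "q1 \<in> rel_span (Suc d) (Suc c) m" "r1 \<in> wdeg_le (Suc d) (m - int (Suc d))"
    "p = q1 + poly_var (Suc d) * r1"
    "q2 \<in> rel_span (Suc d) (Suc c) m" "r2 \<in> wdeg_le (Suc d) (m - int (Suc d))"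
    "q = q2 + poly_var (Suc d) * r2"
    by blast
  then show ?case
    by (intro exI[of _ "q1 + q2"] exI[of _ "r1 + r2"])
      (auto intro: wdeg_le_add rel_span.add simp: algebra_simps)
qed

text \<open>Convolution in degree c + d: terms with i > d vanish by truncation, and the term i = d
  is the left-hand side.\<close>

lemma var_mult_inv_poly:
  assumes "1 \<le> d"
  shows "poly_var d * inv_poly d c =
    - (\<Sum>i<d. trunc_seq d poly_var i * inv_poly d (c + d - i))"
proof -
  have "0 = (\<Sum>i\<le>c + d. trunc_seq d poly_var i * inv_poly d (c + d - i))"
    using assms by (simp add: inv_series_convolution)
  also have "\<dots> = (\<Sum>i\<le>d. trunc_seq d poly_var i * inv_poly d (c + d - i))"
    by (rule sum.mono_neutral_right) (auto simp: trunc_seq_def)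
  also have "\<dots> = (\<Sum>i<d. trunc_seq d poly_var i * inv_poly d (c + d - i)) + poly_var d * inv_poly d c"
    using assms by (simp add: lessThan_Suc_atMost[symmetric] trunc_seq_def)
  finally show ?thesis by (simp add: eq_neg_iff_add_eq_0 add.commute)
qed

text \<open>Monomials gain one factor, and most relations stay in range. The relation of index c + 1
  drops out of it; \<open>var_mult_inv_poly\<close> replaces it by those of index c + 2 to c + 1 +
  Suc d.\<close>

lemma rel_span_var_mult:
  "p \<in> rel_span (Suc d) c m \<Longrightarrow>
    poly_var (Suc d) * p \<in> rel_span (Suc d) (Suc c) (m + int (Suc d))"
proof (induction rule: rel_span.induct)
  case (mon b a)
  then have "poly_var (Suc d) * b \<in> set (monomials (Suc d) (Suc c))"
    by (auto simp del: mult.commute)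
  then show ?case
    unfolding mult.left_commute[of "poly_var (Suc d)"] by (rule rel_span.mon)
next
  case (rel k g)
  show ?case
  proof (cases "k = Suc c")
    case False
    have "poly_var (Suc d) * g \<in> wdeg_le (Suc d) (m + int (Suc d) - int k)"
      by (rule wdeg_le_var_mult[OF rel(3)]) auto
    then have "poly_var (Suc d) * g * inv_poly (Suc d) k \<in> rel_span (Suc d) (Suc c) (m + int (Suc d))"
      using rel False by (intro rel_span.rel) auto
    then show ?thesis by (simp add: mult.assoc)
  next
    case True
    have "poly_var (Suc d) * (g * inv_poly (Suc d) k) =
      (\<Sum>i<Suc d. - (trunc_seq (Suc d) poly_var i * g) * inv_poly (Suc d) (k + Suc d - i))"
      using var_mult_inv_poly[of "Suc d" k]
      by (simp add: mult.left_commute[of _ g] sum_distrib_left sum_negf del: sum.lessThan_Suc)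
        (simp add: mult.assoc mult.left_commute[of _ g])
    also have "\<dots> \<in> rel_span (Suc d) (Suc c) (m + int (Suc d))"
    proof (rule rel_span_sum, rule rel_span.rel)
      fix i assume i: "i \<in> {..<Suc d}"
      show "Suc c < k + Suc d - i" "k + Suc d - i \<le> Suc c + Suc d" using i True by auto
      show "- (trunc_seq (Suc d) poly_var i * g) \<in>
          wdeg_le (Suc d) (m + int (Suc d) - int (k + Suc d - i))"
        by (intro wdeg_le_uminus trunc_seq_wdeg)
          (use rel(3) i in \<open>auto simp: of_nat_diff algebra_simps\<close>)
    qed
    finally show ?thesis .
  qed
qed (auto intro: rel_span.intros simp: distrib_left)

text \<open>The part free of the last variable is reduced with parameters (d, Suc c); its error term
  joins the coefficient of the last variable, which is reduced with (Suc d, c).\<close>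

lemma wdeg_le_subset_rel_span: "p \<in> wdeg_le d m \<Longrightarrow> p \<in> rel_span d c m"
proof (induction d c arbitrary: p m rule: monomials.induct)
  case (1 c)
  have "\<exists>a. p = poly_const a"
    using 1 by (induction rule: wdeg_le_induct)
      (auto simp: poly_const_add[symmetric] intro: exI[of _ 0])
  then show ?case
    using rel_span.mon[of 1 0 c _ m] by auto
next
  case (2 d)
  then show ?case
  proof (induction rule: wdeg_le_induct)
    case (const m a)
    then show ?case
      using rel_span.mon[of 1 "Suc d" 0 _ m] by auto
  next
    case (var i p m)
    let ?X = "trunc_seq (Suc d) poly_var" and ?G = "inv_poly (Suc d)"
    \<comment> \<open>For c = 0 every relation of index 1 to Suc d is available. Isolating the term
      l = 0 of the convolution in degree i writes the variable i through them.\<close>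
    have "0 = (\<Sum>l\<le>i. ?X (i - l) * ?G l)"
      using inv_series_convolution[of ?X i] var(1) sum.nat_diff_reindex[of "\<lambda>l. ?X l * ?G (i - l)" "Suc i"]
      by (simp add: lessThan_Suc_atMost)
    also have "{..i} = insert 0 {1..i}" by auto
    finally have "poly_var i = - (\<Sum>l\<in>{1..i}. ?X (i - l) * ?G l)"
      using var(1,2) by (simp add: trunc_seq_def[of _ _ i] eq_neg_iff_add_eq_0)
    then have "poly_var i * p = (\<Sum>l\<in>{1..i}. - (?X (i - l) * p) * ?G l)"
      by (simp add: sum_negf sum_distrib_left mult_ac)
    also have "\<dots> \<in> rel_span (Suc d) 0 m"
    proof (rule rel_span_sum, rule rel_span.rel)
      fix l assume l: "l \<in> {1..i}"
      show "0 < l" "l \<le> 0 + Suc d" using l var by auto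
      show "- (?X (i - l) * p) \<in> wdeg_le (Suc d) (m - int l)"
        by (intro wdeg_le_uminus trunc_seq_wdeg) (use l var in \<open>auto simp: of_nat_diff\<close>)
    qed
    finally show ?case .
  qed (auto intro: rel_span.intros)
next
  case (3 d c)
  let ?D = "Suc d"
  obtain q r where qr: "q \<in> wdeg_le d m" "r \<in> wdeg_le ?D (m - int ?D)" "p = q + poly_var ?D * r"
    using wdeg_le_split[OF 3(3)] by blast
  obtain q' r' where qr': "q' \<in> rel_span ?D (Suc c) m" "r' \<in> wdeg_le ?D (m - int ?D)"
    "q = q' + poly_var ?D * r'"
    using rel_span_restrict[OF 3(1)[OF qr(1)]] by blast
  have "r' + r \<in> rel_span ?D c (m - int ?D)"
    by (rule 3(2)) (use qr qr' in \<open>auto intro: wdeg_le_add\<close>)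
  then have "poly_var ?D * (r' + r) \<in> rel_span ?D (Suc c) m"
    using rel_span_var_mult by fastforce
  then show ?case
    using qr(3) qr'(3) rel_span.add[OF qr'(1), of "poly_var ?D * (r' + r)"]
    by (simp add: distrib_left add.assoc)
qed

section \<open>The determinants Y_k\<close>

text \<open>A column operation with determinant 1 leaves a first column whose only nonzero entry can
  be the last one, and Laplace expansion along it finishes.\<close>

lemma det_Toeplitz_Hessenberg:
  fixes x :: "nat \<Rightarrow> 'a::comm_ring_1"
  assumes x0: "x 0 = 1"
  shows "det (mat k k (\<lambda>(i, j). if j \<le> i + 1 then x (i + 1 - j) else 0)) = (-1) ^ k * inv_series x k"
proof (cases k)
  case 0
  then show ?thesis by simp
next
  case (Suc m)
  let ?g = "inv_series x"
  define A where "A = mat k k (\<lambda>(i, j). if j \<le> i + 1 then x (i + 1 - j) else 0)"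
  \<comment> \<open>Multiplication by E replaces the first column of A by the combination of all
    columns with weights \<open>?g\<close>.\<close>
  define E where "E = mat k k (\<lambda>(i, j). if j = 0 then ?g i else if i = j then 1 else 0)"
  define B where "B = mat k k (\<lambda>(i, j). if j = 0 then (if i = m then - ?g k else 0) else A $$ (i, j))"
  have cA: "A \<in> carrier_mat k k" and cE: "E \<in> carrier_mat k k" and cB: "B \<in> carrier_mat k k"
    by (auto simp: A_def E_def B_def)
  have col0: "(\<Sum>l<k. A $$ (i, l) * ?g l) = (if i = m then - ?g k else 0)" if i: "i < k" for i
  proof -
    have conv: "(\<Sum>l\<le>i + 1. x (i + 1 - l) * ?g l) = 0"
      using inv_series_convolution[where x = x, OF x0, of "i + 1"] sum.nat_diff_reindex[of "\<lambda>l. x l * ?g (i + 1 - l)" "i + 2"]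
      by (simp add: lessThan_Suc_atMost)
    have *: "(\<Sum>l<k. A $$ (i, l) * ?g l) = (\<Sum>l\<in>{..<k} \<inter> {..i + 1}. x (i + 1 - l) * ?g l)"
      by (rule sum.mono_neutral_cong_right) (use i in \<open>auto simp: A_def\<close>)
    show ?thesis
    \<comment> \<open>Row m has no column k, so the convolution lacks its term l = k, which is
      \<open>?g k\<close>; this leaves \<open>- ?g k\<close>.\<close>
    proof (cases "i = m")
      case True
      then have "{..<k} \<inter> {..i + 1} = {..i}" "k = Suc i" using Suc by auto
      then show ?thesis
        using * conv True x0 by (simp add: eq_neg_iff_add_eq_0)
    next
      case False
      then have "{..<k} \<inter> {..i + 1} = {..i + 1}" using i Suc by auto
      then show ?thesis using * conv False by simp
    qed
  qed
  have AE: "A * E = B"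
  proof (rule eq_matI)
    fix i j assume "i < dim_row B" "j < dim_col B"
    then have ij: "i < k" "j < k" using cB by auto
    have "(A * E) $$ (i, j) = (\<Sum>l<k. A $$ (i, l) * E $$ (l, j))"
      using ij cA cE by (simp add: scalar_prod_def lessThan_atLeast0)
    also have "\<dots> = B $$ (i, j)"
    proof (cases "j = 0")
      case True
      then have "(\<Sum>l<k. A $$ (i, l) * E $$ (l, j)) = (\<Sum>l<k. A $$ (i, l) * ?g l)"
        using ij by (intro sum.cong) (auto simp: E_def)
      then show ?thesis using ij True col0 by (simp add: B_def)
    next
      case False
      then have "(\<Sum>l<k. A $$ (i, l) * E $$ (l, j)) = (\<Sum>l<k. if l = j then A $$ (i, l) else 0)"
        using ij by (intro sum.cong) (auto simp: E_def)
      then show ?thesis using ij False by (simp add: B_def)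
    qed
    finally show "(A * E) $$ (i, j) = B $$ (i, j)" .
  qed (use cA cE cB in auto)
  have unitri: "det C = 1" if "C \<in> carrier_mat r r" "\<And>i j. i < j \<Longrightarrow> j < r \<Longrightarrow> C $$ (i, j) = 0"
    "\<And>i. i < r \<Longrightarrow> C $$ (i, i) = 1" for C :: "'a mat" and r
  proof -
    have "det C = prod_list (diag_mat C)" by (rule det_lower_triangular[OF that(2,1)])
    also have "diag_mat C = map (\<lambda>i. 1) [0..<r]"
      unfolding diag_mat_def using that by (intro map_cong) auto
    finally show ?thesis by (simp add: map_replicate_const)
  qed
  have detE: "det E = 1"
    by (rule unitri[OF cE]) (auto simp: E_def)
  \<comment> \<open>Deleting the last row and the first column moves the superdiagonal entries
    \<open>x 0 = 1\<close> onto the diagonal of a lower triangular matrix.\<close>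
  have "det (mat_delete B m 0) = 1"
    by (rule unitri[of _ m]) (use Suc x0 in \<open>auto simp: mat_delete_def B_def A_def\<close>)
  then have cof: "cofactor B m 0 = (-1) ^ m" by (simp add: cofactor_def)
  have "det B = (\<Sum>i<k. B $$ (i, 0) * cofactor B i 0)"
    by (rule laplace_expansion_column[OF cB]) (use Suc in simp)
  also have "\<dots> = B $$ (m, 0) * cofactor B m 0 + (\<Sum>i\<in>{..<k} - {m}. B $$ (i, 0) * cofactor B i 0)"
    by (rule sum.remove) (use Suc in auto)
  also have "(\<Sum>i\<in>{..<k} - {m}. B $$ (i, 0) * cofactor B i 0) = 0"
    by (rule sum.neutral) (use Suc in \<open>auto simp: B_def\<close>)
  also have "B $$ (m, 0) = - ?g k" using Suc by (simp add: B_def)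
  finally have "det B = (-1) ^ k * ?g k"
    using Suc by (simp add: cof mult.commute)
  then have "det A = (-1) ^ k * ?g k"
    using det_mult[OF cA cE] AE detE by simp
  then show ?thesis by (simp add: A_def)
qed

text \<open>The entries depend only on i - j, so numbering rows and columns from 0 does not alter
  the matrix.\<close>

lemma Y_poly_eq: "Y_poly d k = (-1) ^ k * inv_poly d k"
proof -
  have "mat k k (\<lambda>(i, j). X_ext d (int i - int j + 1)) =
    mat k k (\<lambda>(i, j). if j \<le> i + 1 then trunc_seq d poly_var (i + 1 - j) else 0)"
  proof (rule eq_matI, goal_cases)
    case (1 i j)
    then have ij: "i < k" "j < k" by auto
    show ?case
    proof (cases "j \<le> i + 1")
      case True
      then have "int i - int j + 1 = int (i + 1 - j)" by simp
      then have "X_ext d (int i - int j + 1) = trunc_seq d poly_var (i + 1 - j)"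
        by (simp only: X_ext_def trunc_seq_def nat_int) auto
      then show ?thesis using ij True by simp
    next
      case False
      then show ?thesis using ij by (auto simp: X_ext_def)
    qed
  qed auto
  then show ?thesis
    unfolding Y_poly_def using det_Toeplitz_Hessenberg[of "trunc_seq d poly_var" k] by simp
qed

section \<open>The polynomial ring in d variables\<close>

abbreviation polys :: "nat \<Rightarrow> cpoly set" where
  "polys d \<equiv> carrier (polynomial_ring d)"

lemma polys_iff: "p \<in> polys d \<longleftrightarrow> (\<forall>m\<in>Poly_Mapping.keys p. Poly_Mapping.keys m \<subseteq> {1..d})"
  by (simp add: polynomial_ring_def)

lemma polys_const [simp]: "poly_const a \<in> polys d"
  by (auto simp: polys_iff poly_const_def)

lemma polys_0 [simp]: "0 \<in> polys d" and polys_1 [simp]: "1 \<in> polys d"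
  by (auto simp: polys_iff)

lemma polys_var [simp]: "1 \<le> i \<Longrightarrow> i \<le> d \<Longrightarrow> poly_var i \<in> polys d"
  by (auto simp: polys_iff poly_var_def)

lemma polys_add [simp]: "p \<in> polys d \<Longrightarrow> q \<in> polys d \<Longrightarrow> p + q \<in> polys d"
  using keys_add[of p q] unfolding polys_iff by blast

lemma polys_uminus [simp]: "p \<in> polys d \<Longrightarrow> - p \<in> polys d"
  by (simp add: polys_iff)

lemma polys_mult [simp]: "p \<in> polys d \<Longrightarrow> q \<in> polys d \<Longrightarrow> p * q \<in> polys d"
  unfolding polys_iff
proof
  fix m assume p: "\<forall>m\<in>Poly_Mapping.keys p. Poly_Mapping.keys m \<subseteq> {1..d}"
    and q: "\<forall>m\<in>Poly_Mapping.keys q. Poly_Mapping.keys m \<subseteq> {1..d}"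
    and "m \<in> Poly_Mapping.keys (p * q)"
  then obtain a b where ab: "m = a + b" "a \<in> Poly_Mapping.keys p" "b \<in> Poly_Mapping.keys q"
    using keys_mult[of p q] by blast
  then show "Poly_Mapping.keys m \<subseteq> {1..d}"
    using keys_add[of a b] p q by blast
qed

lemma polys_diff [simp]: "p \<in> polys d \<Longrightarrow> q \<in> polys d \<Longrightarrow> p - q \<in> polys d"
  using polys_add[of p d "- q"] polys_uminus by simp

lemma polys_prod [simp]: "(\<And>i. i \<in> I \<Longrightarrow> f i \<in> polys d) \<Longrightarrow> prod f I \<in> polys d"
  by (induction I rule: infinite_finite_induct) auto

lemma wdeg_le_polys: "p \<in> wdeg_le d m \<Longrightarrow> p \<in> polys d"
  by (induction rule: wdeg_le_induct) auto

lemma monomial_wdeg: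
  "Poly_Mapping.keys m \<subseteq> {1..d} \<Longrightarrow> \<exists>N::nat. Poly_Mapping.single m a \<in> wdeg_le d (int N)"
proof (induction m rule: update_induct)
  case const
  show ?case using wdeg_le_const[of 0 a d] by (intro exI[of _ 0]) (simp add: poly_const_def)
next
  case (update f i k)
  have "Poly_Mapping.keys (Poly_Mapping.update i k f) = insert i (Poly_Mapping.keys f)"
    using update by (auto simp: in_keys_iff lookup_update split: if_splits)
  with update obtain N :: nat where N: "Poly_Mapping.single f a \<in> wdeg_le d (int N)" and i: "1 \<le> i" "i \<le> d"
    by auto
  have *: "Poly_Mapping.update i k f = Poly_Mapping.single i k + f"
    using update(1) by (intro poly_mapping_eqI)
      (auto simp: lookup_update lookup_add lookup_single in_keys_iff)
  have "Poly_Mapping.single (Poly_Mapping.single i k + f) a \<in> wdeg_le d (int (N + k * i))" for k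
  proof (induction k)
    case (Suc k)
    have "Poly_Mapping.single i (Suc k) + f = Poly_Mapping.single i 1 + (Poly_Mapping.single i k + f)"
      using single_add[of i 1 k] by (simp add: add.assoc)
    then have "Poly_Mapping.single (Poly_Mapping.single i (Suc k) + f) a =
        poly_var i * Poly_Mapping.single (Poly_Mapping.single i k + f) a"
      by (simp add: poly_var_def mult_single)
    then show ?case
      using wdeg_le_var_mult[OF Suc i, of "int (N + Suc k * i)"] by (simp add: algebra_simps)
  qed (use N in simp)
  then show ?case unfolding * by blast
qed

lemma polys_wdeg: "p \<in> polys d \<Longrightarrow> \<exists>N::nat. p \<in> wdeg_le d (int N)"
  unfolding polys_iff
proof (induction p rule: update_induct)
  case const
  show ?case using wdeg_le_zero by blast
next
  case (update f m a)
  have "Poly_Mapping.keys (Poly_Mapping.update m a f) = insert m (Poly_Mapping.keys f)"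
    using update by (auto simp: in_keys_iff lookup_update split: if_splits)
  with update obtain N N' :: nat where "f \<in> wdeg_le d (int N)" "Poly_Mapping.single m a \<in> wdeg_le d (int N')"
    using monomial_wdeg[of m d a] by auto
  then have "f + Poly_Mapping.single m a \<in> wdeg_le d (int (max N N'))"
    by (intro wdeg_le_add; elim wdeg_le_mono) auto
  moreover have "Poly_Mapping.update m a f = f + Poly_Mapping.single m a"
    using update(1) by (intro poly_mapping_eqI)
      (auto simp: lookup_update lookup_add lookup_single in_keys_iff)
  ultimately show ?case by auto
qed

text \<open>The rules of \<open>wdeg_bound\<close> give an induction that multiplies by one variable
  at a time, so monomials need not be handled.\<close>

lemma polys_induct [consumes 1, case_names const var add]:
  assumes "p \<in> polys d" "\<And>a. P (poly_const a)"
    and "\<And>i p. 1 \<le> i \<Longrightarrow> i \<le> d \<Longrightarrow> p \<in> polys d \<Longrightarrow> P p \<Longrightarrow> P (poly_var i * p)"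
    and "\<And>p q. p \<in> polys d \<Longrightarrow> P p \<Longrightarrow> q \<in> polys d \<Longrightarrow> P q \<Longrightarrow> P (p + q)"
  shows "P p"
proof -
  obtain N :: nat where "p \<in> wdeg_le d (int N)" using polys_wdeg assms(1) by blast
  then show ?thesis
  proof (induction rule: wdeg_le_induct)
    case (zero m)
    show ?case using assms(2)[of 0] by simp
  qed (use assms(2-4) wdeg_le_polys in blast)+
qed

lemma cpoly_eval_cong:
  "p \<in> polys d \<Longrightarrow> (\<And>i. 1 \<le> i \<Longrightarrow> i \<le> d \<Longrightarrow> x i = y i) \<Longrightarrow> cpoly_eval x p = cpoly_eval y p"
  by (induction rule: polys_induct) auto

lemma inv_poly_polys [simp]: "inv_poly d k \<in> polys d"
  using inv_poly_wdeg wdeg_le_polys by blast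

section \<open>Normal forms over C[Y_n] and their independence on a fibre\<close>

text \<open>The value f(q) by Horner's scheme, with the coefficients of f embedded as
  constants.\<close>

definition cpoly_subst :: "cpoly \<Rightarrow> complex poly \<Rightarrow> cpoly" where
  "cpoly_subst q f = fold_coeffs (\<lambda>a r. poly_const a + q * r) f 0"

lemma cpoly_subst_0 [simp]: "cpoly_subst q 0 = 0"
  by (simp add: cpoly_subst_def)

lemma cpoly_subst_pCons [simp]: "cpoly_subst q (pCons a f) = poly_const a + q * cpoly_subst q f"
  by (cases "a = 0 \<and> f = 0") (auto simp: cpoly_subst_def)

lemma cpoly_subst_add: "cpoly_subst q (f + g) = cpoly_subst q f + cpoly_subst q g"
  by (induction f g rule: poly_induct2) (simp_all add: poly_const_add algebra_simps)

lemma cpoly_eval_subst [simp]: "cpoly_eval x (cpoly_subst q f) = poly f (cpoly_eval x q)"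
  by (induction f) simp_all

text \<open>The normal forms: combinations of the spanning monomials over C[Y_n], with
  \<open>inv_poly d (d + c)\<close>, which is Y_n up to sign, as the generator.\<close>

definition mon_comb :: "nat \<Rightarrow> nat \<Rightarrow> (nat \<Rightarrow> complex poly) \<Rightarrow> cpoly" where
  "mon_comb d c f =
    (\<Sum>i<(d + c) choose d. cpoly_subst (inv_poly d (d + c)) (f i) * monomials d c ! i)"

text \<open>Values of x outside 1, ..., d are left free, so many x represent one point of the
  variety.\<close>

definition relation_locus :: "nat \<Rightarrow> nat \<Rightarrow> (nat \<Rightarrow> complex) set" where
  "relation_locus d c = {x. \<forall>k. c < k \<and> k < d + c \<longrightarrow> inv_series (trunc_seq d x) k = 0}"

text \<open>Strong induction on the weight. J is kept abstract because the lemma serves twice: for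
  the vanishing ideal in \<open>fibre_independence\<close> and for the relation ideal at the
  end.\<close>

lemma spanning_mod_ideal:
  assumes J0: "0 \<in> J" and Jadd: "\<And>p q. p \<in> J \<Longrightarrow> q \<in> J \<Longrightarrow> p + q \<in> J"
    and Jmult: "\<And>p q. p \<in> polys d \<Longrightarrow> q \<in> J \<Longrightarrow> p * q \<in> J"
    and Jrel: "\<And>k. c < k \<Longrightarrow> k < d + c \<Longrightarrow> inv_poly d k \<in> J"
    and d: "1 \<le> d" and p: "p \<in> polys d"
  shows "\<exists>f. p - mon_comb d c f \<in> J"
proof -
  let ?q = "inv_poly d (d + c)" and ?M = "(d + c) choose d"
  define S where "S = {p. \<exists>f. p - mon_comb d c f \<in> J}"
  have S_J: "p \<in> S" if "p \<in> J" for p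
    using that by (auto simp: S_def mon_comb_def intro!: exI[of _ "\<lambda>_. 0"])
  have S_add: "p + p' \<in> S" if ps: "p \<in> S" "p' \<in> S" for p p'
  proof -
    obtain f f' where "p - mon_comb d c f \<in> J" "p' - mon_comb d c f' \<in> J"
      using ps by (auto simp: S_def)
    then have "(p - mon_comb d c f) + (p' - mon_comb d c f') \<in> J" by (rule Jadd)
    moreover have "mon_comb d c (\<lambda>i. f i + f' i) = mon_comb d c f + mon_comb d c f'"
      by (simp add: mon_comb_def cpoly_subst_add distrib_right sum.distrib)
    ultimately have "(p + p') - mon_comb d c (\<lambda>i. f i + f' i) \<in> J"
      by (simp add: algebra_simps)
    then show ?thesis by (auto simp: S_def)
  qed
  have S_q: "?q * p \<in> S" if ps: "p \<in> S" for p
  proof -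
    obtain f where "p - mon_comb d c f \<in> J" using ps by (auto simp: S_def)
    then have "?q * (p - mon_comb d c f) \<in> J" by (intro Jmult) auto
    \<comment> \<open>Prefixing a zero coefficient multiplies \<open>f i\<close> by its variable,
      hence its substituted value by \<open>?q\<close>.\<close>
    moreover have "mon_comb d c (\<lambda>i. pCons 0 (f i)) = ?q * mon_comb d c f"
      by (simp add: mon_comb_def sum_distrib_left mult.assoc)
    ultimately have "?q * p - mon_comb d c (\<lambda>i. pCons 0 (f i)) \<in> J"
      by (simp add: algebra_simps)
    then show ?thesis by (auto simp: S_def)
  qed
  have S_mon: "poly_const a * b \<in> S" if b: "b \<in> set (monomials d c)" for a b
  proof -
    obtain j where j: "j < ?M" "b = monomials d c ! j"
      using b by (auto simp: in_set_conv_nth length_monomials)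
    define f where "f i = (if i = j then [:a:] else 0)" for i
    have "mon_comb d c f = (\<Sum>i<?M. if i = j then poly_const a * b else 0)"
      unfolding mon_comb_def using j by (intro sum.cong) (auto simp: f_def)
    also have "\<dots> = poly_const a * b" using j by simp
    finally show ?thesis using J0 by (auto simp: S_def intro!: exI[of _ f])
  qed
  have "p \<in> wdeg_le d (int N) \<Longrightarrow> p \<in> S" for p N
  proof (induction N arbitrary: p rule: less_induct)
    case (less N)
    have "p \<in> rel_span d c (int N)" using less(2) by (rule wdeg_le_subset_rel_span)
    then show ?case
    proof (induction rule: rel_span.induct)
      case (rel k g)
      show ?case
      proof (cases "k = d + c")
        case False
        then have "g * inv_poly d k \<in> J"
          using rel wdeg_le_polys[OF rel(3)] by (intro Jmult Jrel) auto
        then show ?thesis by (rule S_J)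
      next
        case True
        show ?thesis
        proof (cases "k \<le> N")
          case True
          \<comment> \<open>The relation of index d + c need not lie in J, but it multiplies a g of
            weight N - k < N, to which the induction applies.\<close>
          then have "g \<in> wdeg_le d (int (N - k))" using rel(3) by (simp add: of_nat_diff)
          then have "g \<in> S" by (rule less(1)[rotated]) (use True \<open>k = d + c\<close> d in auto)
          then show ?thesis using S_q \<open>k = d + c\<close> by (simp add: mult.commute)
        next
          case False
          then have "g = 0" using wdeg_le_negative[OF rel(3)] by auto
          then show ?thesis using S_J[OF J0] by simp
        qed
      qed
    qed (auto intro: S_J J0 S_mon S_add)
  qed
  then have "p \<in> S" using polys_wdeg[OF p] by blast
  then show ?thesis by (simp add: S_def)
qed

lemma separating_polynomial:
  fixes P :: "(nat \<Rightarrow> complex) set"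
  assumes fin: "finite P" and s: "s \<in> P"
    and supp: "\<And>x i. x \<in> P \<Longrightarrow> i \<notin> {1..d} \<Longrightarrow> x i = 0"
  shows "\<exists>p\<in>polys d. \<forall>x\<in>P. cpoly_eval x p = (if x = s then 1 else 0)"
proof -
  have "\<exists>i. i \<in> {1..d} \<and> x i \<noteq> s i" if x: "x \<in> P - {s}" for x
  proof (rule ccontr)
    assume "\<not> ?thesis"
    then have "x i = s i" for i using supp[of x i] supp[OF s, of i] x by (cases "i \<in> {1..d}") auto
    then show False using x by auto
  qed
  then obtain i where i: "\<And>x. x \<in> P - {s} \<Longrightarrow> i x \<in> {1..d} \<and> x (i x) \<noteq> s (i x)" by metis
  \<comment> \<open>Lagrange interpolation: each y other than s contributes a linear factor in a
    coordinate \<open>i y\<close> where the two differ, scaled to be 1 at s.\<close>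
  define p where "p = (\<Prod>y\<in>P - {s}. poly_const (1 / (s (i y) - y (i y))) * (poly_var (i y) - poly_const (y (i y))))"
  have "p \<in> polys d"
    unfolding p_def using i by (intro polys_prod polys_mult polys_diff polys_const polys_var) auto
  moreover have "cpoly_eval s p = 1"
  proof -
    have "1 / (s (i y) - y (i y)) * (s (i y) - y (i y)) = 1" if "y \<in> P - {s}" for y
      using i[OF that] by auto
    then show ?thesis unfolding p_def by (simp del: times_divide_eq_left)
  qed
  moreover have "cpoly_eval x p = 0" if "x \<in> P" "x \<noteq> s" for x
    unfolding p_def using that fin by (auto simp: prod_zero_iff)
  ultimately show ?thesis by (intro bexI[of _ p]) auto
qed

text \<open>On P every indicator function is a combination of the monomials. As there are as many
  points as monomials, the evaluation matrix is square and invertible, and v lies in its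
  kernel.\<close>

lemma fibre_independence:
  assumes P: "finite P" "card P = (d + c) choose d" "P \<subseteq> relation_locus d c"
    and supp: "\<And>x i. x \<in> P \<Longrightarrow> i \<notin> {1..d} \<Longrightarrow> x i = 0"
    and q: "\<And>x. x \<in> P \<Longrightarrow> inv_series (trunc_seq d x) (d + c) = q" and d: "1 \<le> d"
    and v: "\<And>x. x \<in> P \<Longrightarrow> (\<Sum>i<(d + c) choose d. v i * cpoly_eval x (monomials d c ! i)) = 0"
    and j: "j < (d + c) choose d"
  shows "v j = 0"
proof -
  let ?M = "(d + c) choose d"
  obtain e where e: "bij_betw e {..<?M} P"
    using ex_bij_betw_nat_finite[OF P(1)] P(2) by (auto simp: lessThan_atLeast0)
  have eP: "i < ?M \<Longrightarrow> e i \<in> P" for i using bij_betwE[OF e] by auto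
  \<comment> \<open>The full vanishing ideal: reduction modulo it keeps all values on P.\<close>
  define J where "J = {p \<in> polys d. \<forall>x\<in>relation_locus d c. cpoly_eval x p = 0}"
  have "\<exists>f. j < ?M \<longrightarrow> (\<forall>i<?M. (\<Sum>l<?M. poly (f l) q * cpoly_eval (e i) (monomials d c ! l)) = (if i = j then 1 else 0))" for j
  proof (cases "j < ?M")
    case True
    obtain p where p: "p \<in> polys d" "\<And>x. x \<in> P \<Longrightarrow> cpoly_eval x p = (if x = e j then 1 else 0)"
      using separating_polynomial[where d = d, OF P(1) eP[OF True]] supp by blast
    have "\<exists>f. p - mon_comb d c f \<in> J"
      by (rule spanning_mod_ideal[OF _ _ _ _ d p(1)]) (auto simp: J_def relation_locus_def)
    then obtain f where f: "p - mon_comb d c f \<in> J" by blast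
    have "(\<Sum>l<?M. poly (f l) q * cpoly_eval (e i) (monomials d c ! l)) = (if i = j then 1 else 0)"
      if i: "i < ?M" for i
    proof -
      have "cpoly_eval (e i) (p - mon_comb d c f) = 0" using f P(3) eP[OF i] by (auto simp: J_def)
      then have "cpoly_eval (e i) p = (\<Sum>l<?M. poly (f l) q * cpoly_eval (e i) (monomials d c ! l))"
        using q[OF eP[OF i]] by (simp add: mon_comb_def)
      moreover have "e i = e j \<longleftrightarrow> i = j"
        using e i True by (auto simp: bij_betw_def inj_on_def)
      ultimately show ?thesis using p(2)[OF eP[OF i]] by simp
    qed
    then show ?thesis by blast
  qed simp
  then obtain f where f: "\<And>i j. i < ?M \<Longrightarrow> j < ?M \<Longrightarrow>
    (\<Sum>l<?M. poly (f j l) q * cpoly_eval (e i) (monomials d c ! l)) = (if i = j then 1 else 0)"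
    by metis
  define E where "E = mat ?M ?M (\<lambda>(i, l). cpoly_eval (e i) (monomials d c ! l))"
  define C where "C = mat ?M ?M (\<lambda>(l, j). poly (f j l) q)"
  have cE: "E \<in> carrier_mat ?M ?M" and cC: "C \<in> carrier_mat ?M ?M" by (auto simp: E_def C_def)
  have "E * C = 1\<^sub>m ?M"
  proof (rule eq_matI)
    fix i j assume "i < dim_row (1\<^sub>m ?M)" "j < dim_col (1\<^sub>m ?M)"
    then have ij: "i < ?M" "j < ?M" by auto
    have "(E * C) $$ (i, j) = (\<Sum>l<?M. cpoly_eval (e i) (monomials d c ! l) * poly (f j l) q)"
      using ij by (simp add: E_def C_def scalar_prod_def lessThan_atLeast0)
    also have "\<dots> = (if i = j then 1 else 0)" using f[OF ij] by (simp add: mult.commute)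
    finally show "(E * C) $$ (i, j) = 1\<^sub>m ?M $$ (i, j)" using ij by simp
  qed (auto simp: E_def C_def)
  \<comment> \<open>Interpolation gives only a right inverse; squareness, that is the cardinality of
    P, makes it two-sided.\<close>
  then have CE: "C * E = 1\<^sub>m ?M" by (rule mat_mult_left_right_inverse[OF cE cC])
  define w where "w = vec ?M v"
  have cw: "w \<in> carrier_vec ?M" by (simp add: w_def)
  have "E *\<^sub>v w = 0\<^sub>v ?M"
  proof (rule eq_vecI)
    fix i assume "i < dim_vec (0\<^sub>v ?M)"
    then have i: "i < ?M" by simp
    show "(E *\<^sub>v w) $ i = 0\<^sub>v ?M $ i"
      using v[OF eP[OF i]] i
      by (simp add: E_def w_def scalar_prod_def lessThan_atLeast0 mult.commute)
  qed (simp add: E_def)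
  then have "w = C *\<^sub>v 0\<^sub>v ?M"
    using assoc_mult_mat_vec[OF cC cE cw] CE cw by simp
  then have "w = 0\<^sub>v ?M" using cC by (simp add: C_def mult_mat_vec_def scalar_prod_def zero_vec_def)
  then have "w $ j = 0" using j by simp
  then show ?thesis using j by (simp add: w_def)
qed

section \<open>Points of the fibres and the vanishing ideal\<close>

text \<open>Both sides have degree at most n and agree at n + 1 points: 0 and the inverses of the n
  roots.\<close>

lemma prod_roots_of_constant:
  fixes a :: complex
  assumes "a \<noteq> 0" "0 < n"
  shows "(\<Prod>z\<in>{z. z ^ n = a}. [:1, - z:]) = 1 - monom a n"
proof (rule poly_eqI_degree)
  let ?U = "{z. z ^ n = a}"
  have fin: "finite ?U" using assms by (intro finite_nth_roots)
  have card: "card ?U = n" using assms by (rule card_nth_roots)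
  have U0: "0 \<notin> ?U" using assms by auto
  let ?A = "insert 0 (inverse ` ?U)"
  have cardA: "card ?A = Suc n"
    using fin U0 card by (subst card_insert_disjoint) (auto simp: card_image inj_on_def)
  show "degree (\<Prod>z\<in>?U. [:1, - z:]) < card ?A"
  proof -
    have "degree [:1, - z:] \<le> 1" for z :: complex by simp
    then have "(\<Sum>z\<in>?U. degree [:1, - z:]) \<le> n"
      using sum_mono[of ?U "\<lambda>z. degree [:1, - z:]" "\<lambda>_. 1"] card by simp
    then show ?thesis
      using degree_prod_sum_le[OF fin, of "\<lambda>z. [:1, - z:]"] by (simp add: cardA o_def)
  qed
  show "degree (1 - monom a n) < card ?A"
    using degree_diff_le_max[of 1 "monom a n"] degree_monom_le[of a n] by (simp add: cardA)
  fix x assume "x \<in> ?A"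
  then show "poly (\<Prod>z\<in>?U. [:1, - z:]) x = poly (1 - monom a n) x"
  proof
    assume "x = 0"
    then show ?thesis using assms by (simp add: poly_prod poly_monom)
  next
    assume "x \<in> inverse ` ?U"
    then obtain z where z: "z ^ n = a" "x = inverse z" by auto
    then have "z \<noteq> 0" using U0 by auto
    then have "poly (\<Prod>z\<in>?U. [:1, - z:]) x = 0"
      using z fin by (auto simp: poly_prod prod_zero_iff intro!: bexI[of _ z])
    then show ?thesis using z assms by (simp add: poly_monom power_inverse)
  qed
qed

text \<open>One point for each d-element subset S of the n-th roots of a. The last claim,
  \<open>x d \<noteq> 0\<close>, is used later to find a point in the open cell.\<close>

lemma fibre_points:
  fixes a :: complex
  assumes a: "a \<noteq> 0" and d: "1 \<le> d"
  shows "\<exists>P. finite P \<and> card P = (d + c) choose d \<and> P \<subseteq> relation_locus d c \<and>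
    (\<forall>x\<in>P. (\<forall>i. i \<notin> {1..d} \<longrightarrow> x i = 0) \<and> inv_series (trunc_seq d x) (d + c) = a \<and> x d \<noteq> 0)"
proof -
  let ?n = "d + c"
  let ?U = "{z. z ^ ?n = a}"
  have fin: "finite ?U" using a d by (intro finite_nth_roots) auto
  have card: "card ?U = ?n" using a d by (intro card_nth_roots) auto
  have U0: "0 \<notin> ?U" using a d by auto
  define Q where "Q S = (\<Prod>z\<in>S. [:1, - z:])" for S :: "complex set"
  \<comment> \<open>Zero outside 1, ..., d, so that distinct points differ in a coordinate visible
    to polynomials in d variables.\<close>
  define pt where "pt S i = (if i \<in> {1..d} then coeff (Q S) i else 0)" for S i
  define \<S> where "\<S> = {S. S \<subseteq> ?U \<and> card S = d}"
  have deg: "degree (Q S) = card S" if "S \<subseteq> ?U" for S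
  proof -
    have "degree (Q S) = (\<Sum>z\<in>S. degree [:1, - z:])"
      unfolding Q_def by (rule degree_prod_sum_eq) simp
    also have "\<dots> = (\<Sum>z\<in>S. 1)" using that U0 by (intro sum.cong) auto
    finally show ?thesis by simp
  qed
  have c0: "coeff (Q S) 0 = 1" for S
    using poly_0_coeff_0[of "Q S"] by (simp add: Q_def poly_prod)
  have Q_eq: "coeff (Q S) i = trunc_seq d (pt S) i" if "S \<in> \<S>" for S i
    using that deg[of S] c0[of S] by (auto simp: \<S>_def trunc_seq_def pt_def coeff_eq_0)
  have prod: "Q S * Q (?U - S) = 1 - monom a ?n" if "S \<in> \<S>" for S
  proof -
    have "Q ?U = Q S * Q (?U - S)"
      unfolding Q_def using that fin
      by (subst mult.commute) (rule prod.subset_diff, auto simp: \<S>_def)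
    then show ?thesis using prod_roots_of_constant[of a ?n] a d by (simp add: Q_def)
  qed
  have inv: "inv_series (trunc_seq d (pt S)) k = coeff (Q (?U - S)) k" if S: "S \<in> \<S>" and "k < ?n" for S k
    using \<open>k < ?n\<close>
  proof (induction k rule: less_induct)
    case (less k)
    show ?case
    proof (cases "k = 0")
      case True
      then show ?thesis by (simp add: c0)
    next
      case False
      \<comment> \<open>In degrees from 1 to n - 1 the product 1 - a t^n has zero coefficients, so
        the complementary factor obeys the recursion that defines \<open>inv_series\<close>.\<close>
      have "(\<Sum>i\<le>k. coeff (Q S) i * coeff (Q (?U - S)) (k - i)) = 0"
        using arg_cong[OF prod[OF S], of "\<lambda>p. coeff p k"] False less(2) by (simp add: coeff_mult)
      moreover have "{..k} = insert 0 {1..k}" by auto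
      ultimately have "coeff (Q (?U - S)) k = - (\<Sum>i\<in>{1..k}. coeff (Q S) i * coeff (Q (?U - S)) (k - i))"
        by (simp add: c0 eq_neg_iff_add_eq_0)
      also have "\<dots> = - (\<Sum>i\<in>{1..k}. trunc_seq d (pt S) i * inv_series (trunc_seq d (pt S)) (k - i))"
        using less by (intro arg_cong[of _ _ uminus] sum.cong) (auto simp: Q_eq[OF S])
      also have "\<dots> = inv_series (trunc_seq d (pt S)) k"
        using False by (simp add: inv_series.simps[of _ k])
      finally show ?thesis ..
    qed
  qed
  have cardc: "card (?U - S) = c" if "S \<in> \<S>" for S
    using that fin card card_Diff_subset[of S ?U] finite_subset[of S ?U] by (auto simp: \<S>_def)
  have high: "coeff (Q (?U - S)) k = 0" if "S \<in> \<S>" "c < k" for S k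
    using deg[of "?U - S"] cardc[OF that(1)] that(2) by (intro coeff_eq_0) auto
  have locus: "pt S \<in> relation_locus d c" if "S \<in> \<S>" for S
    using inv[OF that] high[OF that] by (auto simp: relation_locus_def)
  have fibre: "inv_series (trunc_seq d (pt S)) ?n = a" if S: "S \<in> \<S>" for S
  proof -
    have "(\<Sum>i\<le>?n. coeff (Q S) i * coeff (Q (?U - S)) (?n - i)) = - a"
      using arg_cong[OF prod[OF S], of "\<lambda>p. coeff p ?n"] d by (simp add: coeff_mult)
    moreover have "{..?n} = insert 0 {1..?n}" by auto
    ultimately have "- a = (\<Sum>i\<in>{1..?n}. coeff (Q S) i * coeff (Q (?U - S)) (?n - i))"
      using high[OF S, of ?n] d by (simp add: c0)
    also have "\<dots> = (\<Sum>i\<in>{1..?n}. trunc_seq d (pt S) i * inv_series (trunc_seq d (pt S)) (?n - i))"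
      by (intro sum.cong) (auto simp: Q_eq[OF S] inv[OF S])
    also have "\<dots> = - inv_series (trunc_seq d (pt S)) ?n"
      using d by (simp add: inv_series.simps[of _ ?n])
    finally show ?thesis by simp
  qed
  have lead: "pt S d \<noteq> 0" if S: "S \<in> \<S>" for S
  proof -
    have "degree (Q S) = d" using S deg[of S] by (auto simp: \<S>_def)
    moreover have "Q S \<noteq> 0" using c0[of S] by auto
    ultimately have "coeff (Q S) d \<noteq> 0" using leading_coeff_0_iff by metis
    then show ?thesis using d by (simp add: pt_def)
  qed
  have inj: "inj_on pt \<S>"
  proof (rule inj_onI)
    fix S T assume ST: "S \<in> \<S>" "T \<in> \<S>" "pt S = pt T"
    then have "Q S = Q T" by (intro poly_eqI) (simp add: Q_eq)
    \<comment> \<open>The zeros of \<open>Q S\<close> are the inverses of the elements of S, so S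
      can be recovered from its point.\<close>
    moreover have roots: "S = {z. z \<noteq> 0 \<and> poly (Q S) (1 / z) = 0}" if "S \<in> \<S>" for S
    proof -
      have "finite S" "0 \<notin> S" using that fin U0 finite_subset by (auto simp: \<S>_def)
      then show ?thesis by (auto simp: Q_def poly_prod prod_zero_iff)
    qed
    ultimately show "S = T" using roots[OF ST(1)] roots[OF ST(2)] by simp
  qed
  have "card \<S> = ?n choose d" unfolding \<S>_def using n_subsets[OF fin, of d] card by simp
  then have "card (pt ` \<S>) = ?n choose d" using card_image[OF inj] by simp
  moreover have "finite (pt ` \<S>)"
    unfolding \<S>_def using fin by (auto intro!: finite_imageI finite_subset[of _ "Pow ?U"])
  ultimately show ?thesis
    using locus fibre lead by (intro exI[of _ "pt ` \<S>"]) (auto simp: pt_def)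
qed

text \<open>A normal form is determined by its values on the fibres over nonzero points, each of which has
  as many points as there are monomials in the spanning set.\<close>

theorem vanishing_ideal_relations:
  assumes J0: "0 \<in> J" and Jadd: "\<And>p q. p \<in> J \<Longrightarrow> q \<in> J \<Longrightarrow> p + q \<in> J"
    and Jmult: "\<And>p q. p \<in> polys d \<Longrightarrow> q \<in> J \<Longrightarrow> p * q \<in> J"
    and Jrel: "\<And>k. c < k \<Longrightarrow> k < d + c \<Longrightarrow> inv_poly d k \<in> J"
    and Jvanish: "\<And>p x. p \<in> J \<Longrightarrow> x \<in> relation_locus d c \<Longrightarrow> cpoly_eval x p = 0"
    and d: "1 \<le> d" and p: "p \<in> polys d"
    and vanish: "\<And>x. x \<in> relation_locus d c \<Longrightarrow> cpoly_eval x p = 0"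
  shows "p \<in> J"
proof -
  let ?M = "(d + c) choose d"
  obtain f where f: "p - mon_comb d c f \<in> J"
    using spanning_mod_ideal[OF J0 Jadd Jmult Jrel d p] by blast
  have "poly (f j) a = 0" if j: "j < ?M" and a: "a \<noteq> 0" for j a
  proof -
    obtain P where P: "finite P" "card P = ?M" "P \<subseteq> relation_locus d c"
      "\<And>x i. x \<in> P \<Longrightarrow> i \<notin> {1..d} \<Longrightarrow> x i = 0"
      "\<And>x. x \<in> P \<Longrightarrow> inv_series (trunc_seq d x) (d + c) = a"
      using fibre_points[OF a d, of c] by metis
    show ?thesis
    \<comment> \<open>On the fibre over a, the coefficient \<open>f i\<close> takes the constant
      value \<open>poly (f i) a\<close>.\<close>
    proof (rule fibre_independence[where d = d and c = c and P = P and q = a and v = "\<lambda>i. poly (f i) a"])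
      fix x assume x: "x \<in> P"
      then have "cpoly_eval x (mon_comb d c f) = 0"
        using Jvanish[OF f, of x] vanish[of x] P(3) by auto
      then show "(\<Sum>i<?M. poly (f i) a * cpoly_eval x (monomials d c ! i)) = 0"
        using P(5)[OF x] by (simp add: mon_comb_def)
    qed (use P d j in auto)
  qed
  then have zero: "f j = 0" if "j < ?M" for j
  proof -
    \<comment> \<open>All nonzero a are roots of \<open>f j\<close>, which is too many for a nonzero
      polynomial.\<close>
    have "infinite (- {0::complex})" by (simp add: infinite_UNIV_char_0)
    moreover have "- {0} \<subseteq> {a. poly (f j) a = 0}"
      using \<open>\<And>j a. j < ?M \<Longrightarrow> a \<noteq> 0 \<Longrightarrow> poly (f j) a = 0\<close> that by auto
    ultimately show ?thesis using poly_roots_finite[of "f j"] finite_subset by blast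
  qed
  then have "mon_comb d c f = 0" by (simp add: mon_comb_def)
  then show ?thesis using f by simp
qed

section \<open>Permutation matrices and longest elements\<close>

lemma perm_mat_carrier [simp]: "perm_mat n \<pi> \<in> carrier_mat n n"
  by (simp add: perm_mat_def)

lemma perm_mat_index: "i < n \<Longrightarrow> j < n \<Longrightarrow> perm_mat n \<pi> $$ (i, j) = (if i = \<pi> j then 1 else 0)"
  by (simp add: perm_mat_def)

lemma perm_mat_id: "perm_mat n id = 1\<^sub>m n"
  by (rule eq_matI) (auto simp: perm_mat_def)

lemma perm_mat_mult:
  assumes "\<And>j. j < n \<Longrightarrow> \<sigma> j < n"
  shows "perm_mat n \<pi> * perm_mat n \<sigma> = perm_mat n (\<pi> \<circ> \<sigma>)"
proof (rule eq_matI)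
  fix i j assume "i < dim_row (perm_mat n (\<pi> \<circ> \<sigma>))" "j < dim_col (perm_mat n (\<pi> \<circ> \<sigma>))"
  then have ij: "i < n" "j < n" by (auto simp: perm_mat_def)
  have "(perm_mat n \<pi> * perm_mat n \<sigma>) $$ (i, j) =
      (\<Sum>k\<in>{0..<n}. (if i = \<pi> k then 1 else 0) * (if k = \<sigma> j then 1 else 0))"
    using ij by (simp add: perm_mat_def scalar_prod_def)
  also have "\<dots> = (if i = \<pi> (\<sigma> j) then 1 else 0)"
    using assms[OF ij(2)] by (subst sum.remove[of _ "\<sigma> j"]) (auto intro: sum.neutral)
  finally show "(perm_mat n \<pi> * perm_mat n \<sigma>) $$ (i, j) = perm_mat n (\<pi> \<circ> \<sigma>) $$ (i, j)"
    using ij by (simp add: perm_mat_def)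
qed (auto simp: perm_mat_def)

lemma perm_mat_inj:
  assumes "\<pi> permutes {0..<n}" "\<sigma> permutes {0..<n}" "perm_mat n \<pi> = perm_mat n \<sigma>"
  shows "\<pi> = \<sigma>"
proof
  fix j
  show "\<pi> j = \<sigma> j"
  proof (cases "j < n")
    case True
    then have "\<pi> j < n" using permutes_in_image[OF assms(1), of j] by auto
    then have "perm_mat n \<sigma> $$ (\<pi> j, j) = 1"
      using True perm_mat_index[of "\<pi> j" n j \<pi>] assms(3) by simp
    then show ?thesis
      using True \<open>\<pi> j < n\<close> by (auto simp: perm_mat_def split: if_splits)
  next
    case False
    then show ?thesis using assms permutes_not_in by (metis atLeastLessThan_iff)
  qed
qed

lemma GL_simps:
  "carrier (GL n) = {A \<in> carrier_mat n n. \<exists>B\<in>carrier_mat n n. B * A = 1\<^sub>m n \<and> A * B = 1\<^sub>m n}"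
  "x \<otimes>\<^bsub>GL n\<^esub> y = x * y" "\<one>\<^bsub>GL n\<^esub> = 1\<^sub>m n"
  by (auto simp: GL_def units_of_def Units_def ring_mat_def)

lemma group_GL: "group (GL n)"
proof -
  interpret ring "ring_mat TYPE(complex) n ()" by (rule ring_mat)
  show ?thesis unfolding GL_def by (rule units_group)
qed

lemma GL_inv_unique:
  assumes "A \<in> carrier_mat n n" "B \<in> carrier_mat n n" "A * B = 1\<^sub>m n"
  shows "A \<in> carrier (GL n)" "inv\<^bsub>GL n\<^esub> A = B"
proof -
  have BA: "B * A = 1\<^sub>m n" using mat_mult_left_right_inverse[OF assms] .
  show A: "A \<in> carrier (GL n)" using assms BA by (auto simp: GL_simps)
  have B: "B \<in> carrier (GL n)" using assms BA by (auto simp: GL_simps)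
  interpret group "GL n" by (rule group_GL)
  show "inv\<^bsub>GL n\<^esub> A = B"
    by (rule inv_equality) (use A B BA in \<open>auto simp: GL_simps(2,3)\<close>)
qed

section \<open>Inversions and reduced words\<close>

text \<open>For d = 0 these are all permutations of {0..<n}, so the Weyl group and its maximal parabolic
  subgroups are treated at once.\<close>

definition block_perm :: "nat \<Rightarrow> nat \<Rightarrow> (nat \<Rightarrow> nat) \<Rightarrow> bool" where
  "block_perm n d \<pi> \<longleftrightarrow> \<pi> permutes {0..<n} \<and> (\<forall>i<n. \<pi> i < d \<longleftrightarrow> i < d)"

definition perm_inversions :: "nat \<Rightarrow> (nat \<Rightarrow> nat) \<Rightarrow> (nat \<times> nat) set" where
  "perm_inversions n \<pi> = {(i, j). i < j \<and> j < n \<and> \<pi> j < \<pi> i}"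

text \<open>The pairs inside one of the blocks {0..<d} and {d..<n}: the only possible inversions of
  a block permutation.\<close>

definition block_pairs :: "nat \<Rightarrow> nat \<Rightarrow> (nat \<times> nat) set" where
  "block_pairs n d = {(i, j). i < j \<and> j < n \<and> (j < d \<or> d \<le> i)}"

text \<open>Reverses each block separately; this will be the longest element, and for d = 0 it is
  the full reversal.\<close>

definition block_rev :: "nat \<Rightarrow> nat \<Rightarrow> nat \<Rightarrow> nat" where
  "block_rev n d i = (if i < d then d - 1 - i else if i < n then n + d - 1 - i else i)"

definition adj_prod :: "nat list \<Rightarrow> nat \<Rightarrow> nat" where
  "adj_prod ks = foldr (\<lambda>k f. Transposition.transpose (k - 1) k \<circ> f) ks id"

lemma adj_prod_simps:
  "adj_prod [] = id"
  "adj_prod (k # ks) = Transposition.transpose (k - 1) k \<circ> adj_prod ks"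
  by (simp_all add: adj_prod_def)

lemma finite_perm_inversions [simp]: "finite (perm_inversions n \<pi>)"
  by (rule finite_subset[of _ "{..<n} \<times> {..<n}"]) (auto simp: perm_inversions_def)

lemma finite_block_pairs [simp]: "finite (block_pairs n d)"
  by (rule finite_subset[of _ "{..<n} \<times> {..<n}"]) (auto simp: block_pairs_def)

lemma permutes_lt: "\<pi> permutes {0..<n::nat} \<Longrightarrow> \<pi> i < n \<longleftrightarrow> i < n"
  using permutes_in_image[of \<pi> "{0..<n}" i] by auto

lemma transpose_adj_permutes:
  "k \<in> {1..n - 1} \<Longrightarrow> Transposition.transpose (k - 1) k permutes {0..<n::nat}"
  by (rule permutes_swap_id) auto

lemma adj_prod_permutes: "set ks \<subseteq> {1..n - 1} \<Longrightarrow> adj_prod ks permutes {0..<n}"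
proof (induction ks)
  case (Cons k ks)
  have "Transposition.transpose (k - 1) k permutes {0..<n}"
    by (rule transpose_adj_permutes) (use Cons in auto)
  moreover have "adj_prod ks permutes {0..<n}" using Cons by simp
  ultimately show ?case
    unfolding adj_prod_simps by (rule permutes_compose[rotated])
qed (simp add: adj_prod_def permutes_id)

lemma foldr_simple_reflection:
  "set ks \<subseteq> {1..n - 1} \<Longrightarrow>
    foldr (\<lambda>k A. simple_reflection n k * A) ks (1\<^sub>m n) = perm_mat n (adj_prod ks)"
proof (induction ks)
  case (Cons k ks)
  have "j < n \<Longrightarrow> adj_prod ks j < n" for j
    using adj_prod_permutes[of ks n] permutes_lt Cons(2) by auto
  then have "simple_reflection n k * perm_mat n (adj_prod ks) = perm_mat n (adj_prod (k # ks))"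
    unfolding simple_reflection_def adj_prod_simps by (rule perm_mat_mult)
  then show ?case using Cons by simp
qed (simp add: adj_prod_def perm_mat_id)

text \<open>Being increasing forces i <= \<sigma> i, and a permutation of an initial segment with
  this property is the identity.\<close>

lemma increasing_permutes_id:
  assumes p: "\<sigma> permutes {0..<n::nat}" and inc: "\<And>k. Suc k < n \<Longrightarrow> \<sigma> k < \<sigma> (Suc k)"
  shows "\<sigma> = id"
proof (rule permutes_natset_ge[OF p], rule ballI)
  fix i assume "i \<in> {0..<n}"
  then have "i < n" by simp
  then show "i \<le> \<sigma> i"
  proof (induction i)
    case (Suc i)
    then show ?case using inc[of i] by simp
  qed simp
qed

lemma transpose_adj_less:
  assumes "(1::nat) \<le> k" "a \<noteq> b" "{a, b} \<noteq> {k - 1, k}"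
  shows "Transposition.transpose (k - 1) k a < Transposition.transpose (k - 1) k b \<longleftrightarrow> a < b"
  using assms unfolding Transposition.transpose_def by (auto simp: doubleton_eq_iff)

text \<open>Swapping the adjacent values k - 1 and k changes no comparison except the one between
  these two, which sit at positions a and b.\<close>

lemma perm_inversions_transpose:
  assumes p: "\<pi> permutes {0..<n}" and k: "k \<in> {1..n - 1}"
    and a: "a < n" "\<pi> a = k - 1" and b: "b < n" "\<pi> b = k"
  shows "perm_inversions n (Transposition.transpose (k - 1) k \<circ> \<pi>) - {(min a b, max a b)} =
    perm_inversions n \<pi> - {(min a b, max a b)}"
    and "(min a b, max a b) \<in> perm_inversions n \<pi> \<longleftrightarrow> b < a"
    and "(min a b, max a b) \<in> perm_inversions n (Transposition.transpose (k - 1) k \<circ> \<pi>) \<longleftrightarrow> a < b"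
proof -
  let ?t = "Transposition.transpose (k - 1) k"
  have "a \<noteq> b" using a b k by auto
  have key: "?t (\<pi> j) < ?t (\<pi> i) \<longleftrightarrow> \<pi> j < \<pi> i"
    if ij: "i < j" "(i, j) \<noteq> (min a b, max a b)" for i j
  proof (rule transpose_adj_less)
    have inj: "\<pi> x = \<pi> y \<Longrightarrow> x = y" for x y
      using permutes_inj[OF p] by (auto dest: injD)
    show "1 \<le> k" using k by simp
    show "\<pi> j \<noteq> \<pi> i" using inj[of j i] ij by auto
    show "{\<pi> j, \<pi> i} \<noteq> {k - 1, k}"
    proof
      assume "{\<pi> j, \<pi> i} = {k - 1, k}"
      then have "(j = a \<and> i = b) \<or> (j = b \<and> i = a)"
        using inj a b by (metis doubleton_eq_iff)
      then show False using ij by (auto simp: min_def max_def split: if_splits)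
    qed
  qed
  show "perm_inversions n (?t \<circ> \<pi>) - {(min a b, max a b)} =
      perm_inversions n \<pi> - {(min a b, max a b)}"
    using key by (auto simp: perm_inversions_def)
  show "(min a b, max a b) \<in> perm_inversions n \<pi> \<longleftrightarrow> b < a"
    using a b k \<open>a \<noteq> b\<close> by (auto simp: perm_inversions_def min_def max_def)
  show "(min a b, max a b) \<in> perm_inversions n (?t \<circ> \<pi>) \<longleftrightarrow> a < b"
    using a b k \<open>a \<noteq> b\<close> by (auto simp: perm_inversions_def min_def max_def)
qed

lemma permutes_preimage:
  assumes "\<pi> permutes {0..<n::nat}" "v < n"
  obtains a where "a < n" "\<pi> a = v"
  using permutes_lt[OF permutes_inv[OF assms(1)], of v] permutes_inverses(1)[OF assms(1), of v]
    assms(2) that by blast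

text \<open>Each letter of a word creates at most one inversion, which bounds the length from
  below.\<close>

lemma card_perm_inversions_adj_prod:
  "set ks \<subseteq> {1..n - 1} \<Longrightarrow> card (perm_inversions n (adj_prod ks)) \<le> length ks"
proof (induction ks)
  case Nil
  have "perm_inversions n (adj_prod []) = {}" by (auto simp: perm_inversions_def adj_prod_def)
  then show ?case by simp
next
  case (Cons k ks)
  let ?p = "adj_prod ks" and ?t = "Transposition.transpose (k - 1) k"
  have p: "?p permutes {0..<n}" using Cons by (intro adj_prod_permutes) simp
  have k: "k \<in> {1..n - 1}" using Cons by simp
  have "k - 1 < n" "k < n" using k by auto
  obtain a where a: "a < n" "?p a = k - 1" using permutes_preimage[OF p \<open>k - 1 < n\<close>] .
  obtain b where b: "b < n" "?p b = k" using permutes_preimage[OF p \<open>k < n\<close>] .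
  have "perm_inversions n (?t \<circ> ?p) \<subseteq> insert (min a b, max a b) (perm_inversions n ?p)"
    using perm_inversions_transpose(1)[OF p k a b] by blast
  then have "card (perm_inversions n (?t \<circ> ?p)) \<le> card (insert (min a b, max a b) (perm_inversions n ?p))"
    by (intro card_mono) auto
  also have "\<dots> \<le> Suc (card (perm_inversions n ?p))" by (simp add: card_insert_if)
  finally have "card (perm_inversions n (?t \<circ> ?p)) \<le> length (k # ks)" using Cons by simp
  then show ?case unfolding adj_prod_simps .
qed

lemma block_perm_inv_less:
  assumes "block_perm n d \<pi>" "a < n" "b < n" "\<pi> a < d" "d \<le> \<pi> b"
  shows "a < b"
  using assms unfolding block_perm_def by (meson leD le_less_linear le_less_trans)

text \<open>Bubble sort on values: a descent of the inverse permutation gives a letter that removes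
  exactly one inversion. The letter d never occurs, so the word is reduced and lies in the parabolic
  subgroup.\<close>

lemma block_perm_reduced_word:
  assumes "block_perm n d \<pi>"
  shows "\<exists>ks. set ks \<subseteq> {1..n - 1} - {d} \<and> length ks = card (perm_inversions n \<pi>) \<and> \<pi> = adj_prod ks"
  using assms
proof (induction "card (perm_inversions n \<pi>)" arbitrary: \<pi> rule: less_induct)
  case less
  have p: "\<pi> permutes {0..<n}" using less(2) by (simp add: block_perm_def)
  let ?\<sigma> = "inv_into UNIV \<pi>"
  have \<sigma>: "?\<sigma> permutes {0..<n}" using p by (rule permutes_inv)
  have \<pi>\<sigma>: "\<pi> (?\<sigma> v) = v" for v using permutes_inverses(1)[OF p] .
  show ?case
  proof (cases "\<forall>k. Suc k < n \<longrightarrow> ?\<sigma> k < ?\<sigma> (Suc k)")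
    case True
    then have "?\<sigma> = id" by (intro increasing_permutes_id[OF \<sigma>]) auto
    then have "\<pi> = id" using \<pi>\<sigma> by auto
    moreover have "perm_inversions n id = {}" by (auto simp: perm_inversions_def)
    ultimately show ?thesis by (intro exI[of _ "[]"]) (simp add: adj_prod_simps)
  next
    case False
    then obtain k' where k': "Suc k' < n" "\<not> ?\<sigma> k' < ?\<sigma> (Suc k')" by blast
    define k where "k = Suc k'"
    define a where "a = ?\<sigma> (k - 1)"
    define b where "b = ?\<sigma> k"
    have k: "k \<in> {1..n - 1}" using k' by (simp add: k_def)
    have a: "a < n" "\<pi> a = k - 1" using permutes_lt[OF \<sigma>] k \<pi>\<sigma> by (auto simp: a_def)
    have b: "b < n" "\<pi> b = k" using permutes_lt[OF \<sigma>] k \<pi>\<sigma> by (auto simp: b_def)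
    have "a \<noteq> b" using a b k by auto
    then have "b < a" using k' by (simp add: a_def b_def k_def)
    \<comment> \<open>The values d - 1 and d lie in different blocks, so their positions are in
      increasing order and cannot form a descent.\<close>
    have "k \<noteq> d"
      using block_perm_inv_less[OF less(2) a(1) b(1)] a b k \<open>b < a\<close> by auto
    let ?t = "Transposition.transpose (k - 1) k"
    note I = perm_inversions_transpose[OF p k a b]
    have "perm_inversions n \<pi> = insert (min a b, max a b) (perm_inversions n (?t \<circ> \<pi>))"
      and "(min a b, max a b) \<notin> perm_inversions n (?t \<circ> \<pi>)"
      using I \<open>b < a\<close> by auto
    then have card: "card (perm_inversions n \<pi>) = Suc (card (perm_inversions n (?t \<circ> \<pi>)))"
      by simp
    have "block_perm n d (?t \<circ> \<pi>)"
      unfolding block_perm_def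
    proof (intro conjI allI impI)
      show "?t \<circ> \<pi> permutes {0..<n}"
        by (rule permutes_compose[OF p transpose_adj_permutes[OF k]])
      fix i assume "i < n"
      then have "\<pi> i < d \<longleftrightarrow> i < d" using less(2) by (simp add: block_perm_def)
      then show "(?t \<circ> \<pi>) i < d \<longleftrightarrow> i < d"
        using \<open>k \<noteq> d\<close> k by (auto simp: Transposition.transpose_def)
    qed
    with less(1)[of "?t \<circ> \<pi>"] card obtain ks where ks: "set ks \<subseteq> {1..n - 1} - {d}"
      "length ks = card (perm_inversions n (?t \<circ> \<pi>))" "?t \<circ> \<pi> = adj_prod ks" by auto
    have "?t \<circ> (?t \<circ> \<pi>) = \<pi>" by (auto simp: fun_eq_iff)
    then have "\<pi> = adj_prod (k # ks)" by (simp only: adj_prod_simps ks(3)[symmetric])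
    then show ?thesis
      using ks(1,2) card k \<open>k \<noteq> d\<close> by (intro exI[of _ "k # ks"] conjI) auto
  qed
qed

lemma weyl_length_perm_mat:
  assumes "\<pi> permutes {0..<n}"
  shows "weyl_length n (perm_mat n \<pi>) = card (perm_inversions n \<pi>)"
  unfolding weyl_length_def
proof (rule Least_equality)
  \<comment> \<open>With d = 0 there is no forbidden letter among 1, ..., n - 1.\<close>
  have "block_perm n 0 \<pi>" using assms by (simp add: block_perm_def)
  then obtain ks where ks: "set ks \<subseteq> {1..n - 1} - {0}" "length ks = card (perm_inversions n \<pi>)"
    "\<pi> = adj_prod ks" using block_perm_reduced_word by blast
  then have "set ks \<subseteq> {1..n - 1}" by auto
  then show "\<exists>ks. set ks \<subseteq> {1..n - 1} \<and> length ks = card (perm_inversions n \<pi>) \<and>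
      perm_mat n \<pi> = foldr (\<lambda>k A. simple_reflection n k * A) ks (1\<^sub>m n)"
    using ks foldr_simple_reflection by metis
next
  fix l assume "\<exists>ks. set ks \<subseteq> {1..n - 1} \<and> length ks = l \<and>
      perm_mat n \<pi> = foldr (\<lambda>k A. simple_reflection n k * A) ks (1\<^sub>m n)"
  then obtain ks where ks: "set ks \<subseteq> {1..n - 1}" "length ks = l"
    "perm_mat n \<pi> = perm_mat n (adj_prod ks)" by (auto simp: foldr_simple_reflection)
  then have "\<pi> = adj_prod ks"
    by (intro perm_mat_inj[OF assms] adj_prod_permutes)
  then show "card (perm_inversions n \<pi>) \<le> l"
    using card_perm_inversions_adj_prod ks by blast
qed

section \<open>Longest elements and the maximal parabolic subgroup\<close>

lemma perm_inversions_subset: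
  assumes "block_perm n d \<pi>"
  shows "perm_inversions n \<pi> \<subseteq> block_pairs n d"
proof clarify
  fix i j assume "(i, j) \<in> perm_inversions n \<pi>"
  then have ij: "i < j" "j < n" "\<pi> j < \<pi> i" by (auto simp: perm_inversions_def)
  then have "\<pi> i < d \<longleftrightarrow> i < d" "\<pi> j < d \<longleftrightarrow> j < d" using assms by (auto simp: block_perm_def)
  then show "(i, j) \<in> block_pairs n d" using ij by (auto simp: block_pairs_def)
qed

lemma block_rev_involution: "d \<le> n \<Longrightarrow> block_rev n d (block_rev n d i) = i"
  by (auto simp: block_rev_def)

lemma block_perm_rev: "d \<le> n \<Longrightarrow> block_perm n d (block_rev n d)"
  unfolding block_perm_def
proof
  assume "d \<le> n"
  show "block_rev n d permutes {0..<n}"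
    unfolding permutes_def
  proof (intro conjI allI impI)
    fix x assume "x \<notin> {0..<n}"
    then show "block_rev n d x = x" using \<open>d \<le> n\<close> by (auto simp: block_rev_def)
  next
    fix y
    show "\<exists>!x. block_rev n d x = y" using block_rev_involution[OF \<open>d \<le> n\<close>] by metis
  qed
  show "\<forall>i<n. (block_rev n d i < d) = (i < d)" by (auto simp: block_rev_def)
qed

lemma perm_inversions_rev: "d \<le> n \<Longrightarrow> perm_inversions n (block_rev n d) = block_pairs n d"
  unfolding perm_inversions_def block_pairs_def block_rev_def by auto

text \<open>If every block pair were inverted, composing with \<open>block_rev\<close> would give an
  increasing map: within a block by the inversions, across the boundary because blocks are
  preserved.\<close>

lemma perm_inversions_less:
  assumes "d \<le> n" "block_perm n d \<pi>" "\<pi> \<noteq> block_rev n d"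
  shows "card (perm_inversions n \<pi>) < card (block_pairs n d)"
proof (rule psubset_card_mono)
  have "perm_inversions n \<pi> \<noteq> block_pairs n d"
  proof
    assume eq: "perm_inversions n \<pi> = block_pairs n d"
    let ?r = "block_rev n d"
    have r: "?r permutes {0..<n}" using block_perm_rev[OF assms(1)] by (simp add: block_perm_def)
    have p: "\<pi> permutes {0..<n}" using assms by (simp add: block_perm_def)
    have "\<pi> \<circ> ?r = id"
    proof (rule increasing_permutes_id[OF permutes_compose[OF r p]])
      fix k assume k: "Suc k < n"
      show "(\<pi> \<circ> ?r) k < (\<pi> \<circ> ?r) (Suc k)"
      proof (cases "Suc k = d")
        case True
        have "\<pi> (?r k) < d" "\<not> \<pi> (?r (Suc k)) < d"
          using assms(2) k True by (auto simp: block_perm_def block_rev_def)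
        then show ?thesis by simp
      next
        case False
        then have "(?r (Suc k), ?r k) \<in> block_pairs n d"
          using k assms(1) by (auto simp: block_pairs_def block_rev_def)
        then show ?thesis using eq by (auto simp: perm_inversions_def)
      qed
    qed
    then have "(\<pi> \<circ> ?r) (?r i) = ?r i" for i by simp
    then have "\<pi> = ?r" using block_rev_involution[OF assms(1)] by (simp add: fun_eq_iff)
    then show False using assms by simp
  qed
  then show "perm_inversions n \<pi> \<subset> block_pairs n d"
    using perm_inversions_subset[OF assms(2)] by blast
qed simp

lemma longest_element_block:
  assumes "d \<le> n"
  shows "longest_element n {perm_mat n \<pi> |\<pi>. block_perm n d \<pi>} = perm_mat n (block_rev n d)"
    (is "longest_element n ?S = ?w")
proof -
  have len: "weyl_length n ?w = card (block_pairs n d)"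
    using weyl_length_perm_mat block_perm_rev[OF assms] perm_inversions_rev[OF assms]
    by (simp add: block_perm_def)
  have max: "?w \<in> ?S \<and> (\<forall>v\<in>?S. v \<noteq> ?w \<longrightarrow> weyl_length n v < weyl_length n ?w)"
  proof (intro conjI ballI impI)
    show "?w \<in> ?S" using block_perm_rev[OF assms] by blast
    fix v assume "v \<in> ?S" "v \<noteq> ?w"
    then obtain \<pi> where \<pi>: "v = perm_mat n \<pi>" "block_perm n d \<pi>" "\<pi> \<noteq> block_rev n d" by auto
    then have "weyl_length n v = card (perm_inversions n \<pi>)"
      by (simp add: weyl_length_perm_mat block_perm_def)
    then show "weyl_length n v < weyl_length n ?w"
      using perm_inversions_less[OF assms \<pi>(2,3)] len by simp
  qed
  show ?thesis
    unfolding longest_element_def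
  proof (rule the_equality)
    show "?w \<in> ?S \<and> (\<forall>v\<in>?S. v \<noteq> ?w \<longrightarrow> weyl_length n v < weyl_length n ?w)" by (rule max)
  next
    fix w assume w: "w \<in> ?S \<and> (\<forall>v\<in>?S. v \<noteq> w \<longrightarrow> weyl_length n v < weyl_length n w)"
    show "w = ?w"
    proof (rule ccontr)
      assume "w \<noteq> ?w"
      then have "weyl_length n w < weyl_length n ?w" "weyl_length n ?w < weyl_length n w"
        using w max by auto
      then show False by simp
    qed
  qed
qed

lemma block_perm_comp: "block_perm n d \<pi> \<Longrightarrow> block_perm n d \<sigma> \<Longrightarrow> block_perm n d (\<pi> \<circ> \<sigma>)"
  unfolding block_perm_def using permutes_compose[of \<sigma> "{0..<n}" \<pi>] permutes_lt[of \<sigma> n] by simp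

lemma block_perm_transpose:
  assumes "k \<in> {1..n - 1} - {d}"
  shows "block_perm n d (Transposition.transpose (k - 1) k)"
  using assms transpose_adj_permutes[of k n]
  by (auto simp: block_perm_def Transposition.transpose_def)

lemma simple_reflection_involution:
  "k \<in> {1..n - 1} \<Longrightarrow> simple_reflection n k * simple_reflection n k = 1\<^sub>m n"
  unfolding simple_reflection_def
  by (subst perm_mat_mult) (use permutes_lt[OF transpose_adj_permutes] in \<open>auto simp: perm_mat_id\<close>)

text \<open>Block permutations are closed under products and contain the generators, which are their
  own inverses; conversely each one has a word avoiding d.\<close>

lemma parabolic_subgroup_block:
  "parabolic_subgroup n ({1..n - 1} - {d}) = {perm_mat n \<pi> |\<pi>. block_perm n d \<pi>}"
    (is "?P = ?S")
proof
  have mult: "a * b \<in> ?S" if "a \<in> ?S" "b \<in> ?S" for a b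
  proof -
    from that obtain \<pi> \<sigma> where "a = perm_mat n \<pi>" "b = perm_mat n \<sigma>"
      "block_perm n d \<pi>" "block_perm n d \<sigma>" by auto
    then show ?thesis
      using perm_mat_mult[of n \<sigma> \<pi>] block_perm_comp[of n d \<pi> \<sigma>] permutes_lt[of \<sigma> n]
      by (auto simp: block_perm_def)
  qed
  have refl: "simple_reflection n k \<in> ?S" if "k \<in> {1..n - 1} - {d}" for k
    using block_perm_transpose[OF that] by (auto simp: simple_reflection_def)
  show "?P \<subseteq> ?S"
  proof
    fix x assume "x \<in> ?P"
    then show "x \<in> ?S"
      unfolding parabolic_subgroup_def
    proof (induction rule: generate.induct)
      case one
      have "block_perm n d id" by (simp add: block_perm_def permutes_id)
      then show ?case by (auto simp: GL_simps(3) perm_mat_id[symmetric] simp del: id_apply)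
    next
      case (incl h)
      then show ?case using refl by blast
    next
      case (inv h)
      then obtain k where k: "k \<in> {1..n - 1} - {d}" "h = simple_reflection n k" by blast
      then have "h * h = 1\<^sub>m n" "h \<in> carrier_mat n n"
        using simple_reflection_involution[of k n] by (auto simp: simple_reflection_def)
      then have "inv\<^bsub>GL n\<^esub> h = h" by (intro GL_inv_unique(2))
      then show ?case using refl k by simp
    next
      case (eng h1 h2)
      then show ?case using mult by (simp add: GL_simps(2))
    qed
  qed
  show "?S \<subseteq> ?P"
  proof
    fix x assume "x \<in> ?S"
    then obtain \<pi> where "x = perm_mat n \<pi>" "block_perm n d \<pi>" by auto
    then obtain ks where ks: "set ks \<subseteq> {1..n - 1} - {d}" "x = perm_mat n (adj_prod ks)"
      using block_perm_reduced_word by blast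
    have "foldr (\<lambda>k A. simple_reflection n k * A) ks (1\<^sub>m n) \<in> ?P"
      using ks(1)
    proof (induction ks)
      case Nil
      then show ?case
        using generate.one[of "GL n"] by (simp add: parabolic_subgroup_def GL_simps(3))
    next
      case (Cons k ks)
      then show ?case
        using generate.eng[of "simple_reflection n k" "GL n"] generate.incl[of "simple_reflection n k" _ "GL n"]
        by (auto simp: parabolic_subgroup_def GL_simps(2))
    qed
    moreover have "set ks \<subseteq> {1..n - 1}" using ks by auto
    ultimately show "x \<in> ?P" using ks foldr_simple_reflection by simp
  qed
qed

text \<open>Reversing each block and then everything restores the order inside the blocks and
  exchanges them.\<close>

lemma w_upper_maximal_parabolic:
  assumes "d \<le> n"
  shows "w_upper n ({1..n - 1} - {d}) =
    perm_mat n (\<lambda>i. if i < d then i + (n - d) else i - d)"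
proof -
  have "weyl_group n = {perm_mat n \<pi> |\<pi>. block_perm n 0 \<pi>}"
    by (simp add: weyl_group_def block_perm_def)
  then have "w_upper n ({1..n - 1} - {d}) = perm_mat n (block_rev n 0) * perm_mat n (block_rev n d)"
    unfolding w_upper_def parabolic_subgroup_block longest_element_block[OF assms]
    by (simp add: longest_element_block)
  also have "\<dots> = perm_mat n (block_rev n 0 \<circ> block_rev n d)"
    using assms by (intro perm_mat_mult) (auto simp: block_rev_def)
  also have "\<dots> = perm_mat n (\<lambda>i. if i < d then i + (n - d) else i - d)"
    using assms by (intro eq_matI) (auto simp: perm_mat_def block_rev_def)
  finally show ?thesis .
qed

section \<open>Toeplitz matrices and the Peterson variety\<close>

definition toeplitz :: "nat \<Rightarrow> (nat \<Rightarrow> complex) \<Rightarrow> complex mat" where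
  "toeplitz n x = mat n n (\<lambda>(i, j). if i \<le> j then x (j - i) else 0)"

lemma toeplitz_carrier [simp]: "toeplitz n x \<in> carrier_mat n n"
  by (simp add: toeplitz_def)

lemma toeplitz_index:
  "i < n \<Longrightarrow> j < n \<Longrightarrow> toeplitz n x $$ (i, j) = (if i \<le> j then x (j - i) else 0)"
  by (simp add: toeplitz_def)

lemma mat_mult_index:
  assumes "A \<in> carrier_mat n n" "B \<in> carrier_mat n n" "i < n" "j < n"
  shows "(A * B) $$ (i, j) = (\<Sum>k<n. A $$ (i, k) * B $$ (k, j))"
  using assms by (simp add: scalar_prod_def lessThan_atLeast0)

text \<open>Upper triangular Toeplitz matrices multiply like power series modulo t^n, so
  \<open>inv_series\<close> describes inverse matrices.\<close>

lemma toeplitz_mult: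
  "toeplitz n x * toeplitz n y = toeplitz n (\<lambda>k. \<Sum>i\<le>k. x i * y (k - i))"
proof (rule eq_matI)
  fix i j assume "i < dim_row (toeplitz n (\<lambda>k. \<Sum>i\<le>k. x i * y (k - i)))"
    "j < dim_col (toeplitz n (\<lambda>k. \<Sum>i\<le>k. x i * y (k - i)))"
  then have ij: "i < n" "j < n" by (auto simp: toeplitz_def)
  have "(toeplitz n x * toeplitz n y) $$ (i, j) =
      (\<Sum>k<n. toeplitz n x $$ (i, k) * toeplitz n y $$ (k, j))"
    by (rule mat_mult_index) (use ij in auto)
  also have "\<dots> = (\<Sum>k\<in>{i..j}. x (k - i) * y (j - k))"
    by (rule sum.mono_neutral_cong_right) (use ij in \<open>auto simp: toeplitz_index\<close>)
  also have "\<dots> = (if i \<le> j then \<Sum>l\<le>j - i. x l * y (j - i - l) else 0)"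
  proof (cases "i \<le> j")
    case True
    have "(\<Sum>k\<in>{i..j}. x (k - i) * y (j - k)) = (\<Sum>l\<le>j - i. x l * y (j - i - l))"
      by (rule sum.reindex_bij_witness[of _ "\<lambda>l. l + i" "\<lambda>k. k - i"]) (use True in auto)
    then show ?thesis using True by simp
  qed simp
  finally show "(toeplitz n x * toeplitz n y) $$ (i, j) =
      toeplitz n (\<lambda>k. \<Sum>i\<le>k. x i * y (k - i)) $$ (i, j)"
    using ij by (simp add: toeplitz_index)
qed (auto simp: toeplitz_def)

lemma toeplitz_inverse:
  assumes "x 0 = 1"
  shows "toeplitz n x * toeplitz n (inv_series x) = 1\<^sub>m n"
    and "toeplitz n (inv_series x) * toeplitz n x = 1\<^sub>m n"
proof -
  show *: "toeplitz n x * toeplitz n (inv_series x) = 1\<^sub>m n"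
    unfolding toeplitz_mult
    by (rule eq_matI)
      (use assms inv_series_convolution[of x] in \<open>auto simp: toeplitz_def simp del: diff_diff_left\<close>)
  show "toeplitz n (inv_series x) * toeplitz n x = 1\<^sub>m n"
    by (rule mat_mult_left_right_inverse[OF _ _ *]) auto
qed

lemma toeplitz_GL: "x 0 = 1 \<Longrightarrow> toeplitz n x \<in> carrier (GL n)"
  by (rule GL_inv_unique(1)[OF _ _ toeplitz_inverse(1)]) auto

lemma det_toeplitz: "x 0 = 1 \<Longrightarrow> det (toeplitz n x) = 1"
proof -
  assume x: "x 0 = 1"
  have "det (toeplitz n x) = prod_list (diag_mat (toeplitz n x))"
    by (rule det_upper_triangular[of _ n]) (auto simp: toeplitz_def)
  also have "diag_mat (toeplitz n x) = map (\<lambda>i. 1) [0..<n]"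
    unfolding diag_mat_def using x by (intro map_cong) (auto simp: toeplitz_def)
  finally show ?thesis by (simp add: map_replicate_const)
qed

lemma nilpotent_mult_left:
  assumes "A \<in> carrier_mat n n" "i < n" "j < n"
  shows "(principal_nilpotent n * A) $$ (i, j) = (if Suc i < n then A $$ (Suc i, j) else 0)"
proof -
  have "(principal_nilpotent n * A) $$ (i, j) =
      (\<Sum>k<n. principal_nilpotent n $$ (i, k) * A $$ (k, j))"
    by (rule mat_mult_index) (use assms in \<open>auto simp: principal_nilpotent_def\<close>)
  also have "\<dots> = (\<Sum>k<n. if k = Suc i then A $$ (Suc i, j) else 0)"
    by (rule sum.cong) (use assms in \<open>auto simp: principal_nilpotent_def\<close>)
  finally show ?thesis by simp
qed

lemma nilpotent_mult_right:
  assumes "A \<in> carrier_mat n n" "i < n" "j < n"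
  shows "(A * principal_nilpotent n) $$ (i, j) = (if j = 0 then 0 else A $$ (i, j - 1))"
proof -
  have "(A * principal_nilpotent n) $$ (i, j) =
      (\<Sum>k<n. A $$ (i, k) * principal_nilpotent n $$ (k, j))"
    by (rule mat_mult_index) (use assms in \<open>auto simp: principal_nilpotent_def\<close>)
  also have "\<dots> = (\<Sum>k<n. if j \<noteq> 0 \<and> k = j - 1 then A $$ (i, j - 1) else 0)"
    by (rule sum.cong) (use assms in \<open>auto simp: principal_nilpotent_def\<close>)
  also have "\<dots> = (if j = 0 then 0 else A $$ (i, j - 1))"
    using assms by (cases "j = 0") auto
  finally show ?thesis .
qed

text \<open>The condition says that u commutes with the shift matrix; comparing entries makes u
  constant along diagonals.\<close>

lemma upper_unipotent_centralizer_eq: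
  "upper_unipotent_centralizer n = {toeplitz n x |x. x 0 = 1}"
proof (intro equalityI subsetI)
  let ?e = "principal_nilpotent n"
  have e: "?e \<in> carrier_mat n n" by (simp add: principal_nilpotent_def)
  fix u
  {
    assume u: "u \<in> upper_unipotent_centralizer n"
    then have U: "u \<in> carrier (GL n)" "\<And>i j. i < n \<Longrightarrow> j < i \<Longrightarrow> u $$ (i, j) = 0"
      "\<And>i. i < n \<Longrightarrow> u $$ (i, i) = 1" and eq: "u * ?e * inv\<^bsub>GL n\<^esub> u = ?e"
      by (auto simp: upper_unipotent_centralizer_def upper_unipotent_def)
    from U obtain v where cu: "u \<in> carrier_mat n n" and v: "v \<in> carrier_mat n n" "v * u = 1\<^sub>m n" "u * v = 1\<^sub>m n"
      by (auto simp: GL_simps)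
    have "u * ?e * v = ?e" using eq GL_inv_unique(2)[OF cu v(1,3)] by simp
    then have "u * ?e * v * u = ?e * u" by simp
    moreover have "u * ?e * v * u = u * ?e * (v * u)"
      by (rule assoc_mult_mat[of _ n n]) (use cu e v in auto)
    ultimately have comm: "u * ?e = ?e * u" using v cu e by simp
    have step: "u $$ (Suc i, Suc j) = u $$ (i, j)" if "Suc i < n" "Suc j < n" for i j
      using arg_cong[OF comm, of "\<lambda>A. A $$ (i, Suc j)"] that cu
        nilpotent_mult_left[OF cu, of i "Suc j"] nilpotent_mult_right[OF cu, of i "Suc j"] by simp
    have shift: "u $$ (i, i + k) = u $$ (0, k)" if "i + k < n" for i k
      using that by (induction i) (use step in auto)
    \<comment> \<open>The value at 0 is set outright, since for n = 0 there is no entry to read it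
      from.\<close>
    define x where "x k = (if k = 0 then 1 else u $$ (0, k))" for k
    have "u = toeplitz n x"
    proof (rule eq_matI)
      fix i j assume "i < dim_row (toeplitz n x)" "j < dim_col (toeplitz n x)"
      then have ij: "i < n" "j < n" by (auto simp: toeplitz_def)
      show "u $$ (i, j) = toeplitz n x $$ (i, j)"
        using ij U(2)[of i j] U(3)[of i] shift[of i "j - i"] by (auto simp: toeplitz_index x_def)
    qed (use cu in \<open>auto simp: toeplitz_def\<close>)
    then show "u \<in> {toeplitz n x |x. x 0 = 1}" by (auto simp: x_def)
  next
    assume "u \<in> {toeplitz n x |x. x 0 = 1}"
    then obtain x where x: "x 0 = 1" and u: "u = toeplitz n x" by auto
    have cu: "u \<in> carrier_mat n n" using u by simp
    let ?v = "toeplitz n (inv_series x)"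
    have comm: "u * ?e = ?e * u"
    proof (rule eq_matI)
      fix i j assume "i < dim_row (?e * u)" "j < dim_col (?e * u)"
      then have ij: "i < n" "j < n" using cu e by auto
      then show "(u * ?e) $$ (i, j) = (?e * u) $$ (i, j)"
        unfolding u nilpotent_mult_left[OF toeplitz_carrier ij] nilpotent_mult_right[OF toeplitz_carrier ij]
        by (cases j) (auto simp: toeplitz_index)
    qed (use cu e in auto)
    have "u * ?e * ?v = ?e * (u * ?v)"
      unfolding comm by (rule assoc_mult_mat[of _ n n _ n _ n]) (use cu e in auto)
    also have "\<dots> = ?e" using toeplitz_inverse(1)[where x = x, OF x, of n] u e by simp
    finally have "u * ?e * inv\<^bsub>GL n\<^esub> u = ?e"
      using GL_inv_unique(2)[OF cu _ toeplitz_inverse(1)[where x = x, OF x, of n, folded u]] by simp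
    then show "u \<in> upper_unipotent_centralizer n"
      using x toeplitz_GL[where x = x, OF x, of n] u
      by (auto simp: upper_unipotent_centralizer_def upper_unipotent_def toeplitz_index)
  }
qed

section \<open>Regular functions and band conditions\<close>

lemma regular_sum: "(\<And>i. i \<in> I \<Longrightarrow> f i \<in> regular_functions n) \<Longrightarrow> (\<lambda>A. \<Sum>i\<in>I. f i A) \<in> regular_functions n"
  by (induction I rule: infinite_finite_induct) (auto intro: regular_functions.intros)

lemma regular_prod: "(\<And>i. i \<in> I \<Longrightarrow> f i \<in> regular_functions n) \<Longrightarrow> (\<lambda>A. \<Prod>i\<in>I. f i A) \<in> regular_functions n"
  by (induction I rule: infinite_finite_induct) (auto intro: regular_functions.intros)

lemma regular_det:
  assumes "\<And>i j. i < m \<Longrightarrow> j < m \<Longrightarrow> (\<lambda>A. f A i j) \<in> regular_functions n"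
  shows "(\<lambda>A. det (mat m m (\<lambda>(i, j). f A i j))) \<in> regular_functions n"
proof -
  have "det (mat m m (\<lambda>(i, j). f A i j)) =
      (\<Sum>p\<in>{p. p permutes {0..<m}}. signof p * (\<Prod>i\<in>{0..<m}. f A i (p i)))" for A
    unfolding det_def using permutes_lt by (auto intro!: sum.cong prod.cong)
  moreover have "(\<lambda>A. \<Sum>p\<in>{p. p permutes {0..<m}}. signof p * (\<Prod>i\<in>{0..<m}. f A i (p i))) \<in> regular_functions n"
    using assms permutes_lt by (intro regular_sum reg_mult reg_const regular_prod) auto
  ultimately show ?thesis by simp
qed

text \<open>A bound on the bandwidth above the diagonal only; e = 0 means lower triangular.
  Bandwidths add under products, so lower triangular factors preserve them.\<close>

definition band :: "nat \<Rightarrow> nat \<Rightarrow> complex mat \<Rightarrow> bool" where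
  "band n e A \<longleftrightarrow> A \<in> carrier_mat n n \<and> (\<forall>i<n. \<forall>j<n. i + e < j \<longrightarrow> A $$ (i, j) = 0)"

lemma band_mult:
  assumes "band n e A" "band n e' B"
  shows "band n (e + e') (A * B)"
  unfolding band_def
proof (intro conjI allI impI)
  have c: "A \<in> carrier_mat n n" "B \<in> carrier_mat n n" using assms by (auto simp: band_def)
  then show "A * B \<in> carrier_mat n n" by simp
  fix i j assume ij: "i < n" "j < n" "i + (e + e') < j"
  have "A $$ (i, k) * B $$ (k, j) = 0" if "k < n" for k
    using assms ij that by (cases "i + e < k") (auto simp: band_def)
  then show "(A * B) $$ (i, j) = 0"
    unfolding mat_mult_index[OF c ij(1,2)] by (intro sum.neutral) simp
qed

lemma lower_borel_band: "A \<in> lower_borel n \<longleftrightarrow> A \<in> carrier (GL n) \<and> band n 0 A"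
  by (auto simp: lower_borel_def band_def GL_simps)

text \<open>Forward substitution, row by row; the diagonal of A has no zero because its product is
  the determinant.\<close>

lemma lower_triangular_inverse:
  assumes A: "band n 0 A" and B: "B \<in> carrier_mat n n" and AB: "A * B = 1\<^sub>m n"
  shows "band n 0 B"
  unfolding band_def
proof (intro conjI allI impI)
  have cA: "A \<in> carrier_mat n n" using A by (simp add: band_def)
  have "det A * det B = 1" using det_mult[OF cA B] AB by simp
  then have "det A \<noteq> 0" by auto
  moreover have "det A = prod_list (diag_mat A)"
    by (rule det_lower_triangular[OF _ cA]) (use A in \<open>auto simp: band_def\<close>)
  ultimately have diag: "A $$ (i, i) \<noteq> 0" if "i < n" for i
    using that cA by (auto simp: diag_mat_def prod_list_zero_iff)
  fix i j assume "i < n" "j < n" "i + 0 < j"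
  then show "B $$ (i, j) = 0"
  proof (induction i rule: less_induct)
    case (less i)
    have "(A * B) $$ (i, j) = 0" using less AB by simp
    then have "0 = (\<Sum>k<n. A $$ (i, k) * B $$ (k, j))"
      using mat_mult_index[OF cA B less(2,3)] by simp
    also have "\<dots> = (\<Sum>k\<in>{i}. A $$ (i, k) * B $$ (k, j))"
    proof (rule sum.mono_neutral_right)
      show "\<forall>k\<in>{..<n} - {i}. A $$ (i, k) * B $$ (k, j) = 0"
      proof
        fix k assume k: "k \<in> {..<n} - {i}"
        show "A $$ (i, k) * B $$ (k, j) = 0"
          using A less(1)[of k] less(2-4) k by (cases "k < i") (auto simp: band_def)
      qed
    qed (use less in auto)
    finally show ?case using diag[OF less(2)] by simp
  qed
qed (rule B)

lemma lower_borel_inverse: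
  assumes "A \<in> lower_borel n"
  obtains B where "B \<in> lower_borel n" "A * B = 1\<^sub>m n" "B * A = 1\<^sub>m n"
proof -
  from assms obtain B where B: "B \<in> carrier_mat n n" "B * A = 1\<^sub>m n" "A * B = 1\<^sub>m n"
    and A: "A \<in> carrier_mat n n" "band n 0 A"
    by (auto simp: lower_borel_band GL_simps)
  then have "band n 0 B" using lower_triangular_inverse by blast
  then have "B \<in> lower_borel n" using A B by (auto simp: lower_borel_band GL_simps)
  then show ?thesis using that B by blast
qed

lemma lower_borelI:
  assumes A: "band n 0 A" and diag: "\<And>i. i < n \<Longrightarrow> A $$ (i, i) \<noteq> 0"
  shows "A \<in> lower_borel n"
proof -
  have cA: "A \<in> carrier_mat n n" using A by (simp add: band_def)
  have "det A = prod_list (diag_mat A)"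
    by (rule det_lower_triangular[OF _ cA]) (use A in \<open>auto simp: band_def\<close>)
  then have "det A \<noteq> 0" using diag cA by (auto simp: diag_mat_def prod_list_zero_iff)
  then have "A \<in> carrier (GL n)"
    unfolding GL_def units_of_def using det_non_zero_imp_unit[OF cA] by simp
  then show ?thesis using A by (simp add: lower_borel_band)
qed

text \<open>The element computed in \<open>w_upper_maximal_parabolic\<close>, with n written as d +
  c so that exchanging d and c gives the inverse.\<close>

definition grassmann_perm :: "nat \<Rightarrow> nat \<Rightarrow> complex mat" where
  "grassmann_perm d c = perm_mat (d + c) (\<lambda>i. if i < d then i + c else i - d)"

lemma grassmann_perm_carrier [simp]: "grassmann_perm d c \<in> carrier_mat (d + c) (d + c)"
  by (simp add: grassmann_perm_def)

lemma grassmann_perm_band: "band (d + c) d (grassmann_perm d c)"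
  by (auto simp: band_def grassmann_perm_def perm_mat_index)

lemma grassmann_perm_inverse: "grassmann_perm d c * grassmann_perm c d = 1\<^sub>m (d + c)"
proof -
  have "grassmann_perm d c * grassmann_perm c d =
      perm_mat (d + c) ((\<lambda>i. if i < d then i + c else i - d) \<circ> (\<lambda>i. if i < c then i + d else i - c))"
    unfolding grassmann_perm_def add.commute[of c d] by (rule perm_mat_mult) auto
  also have "\<dots> = 1\<^sub>m (d + c)"
    by (rule eq_matI) (auto simp: perm_mat_def)
  finally show ?thesis .
qed

text \<open>The entries of the inverse matrix vanish along with those of the adjugate, which are regular.\<close>

lemma zariski_closed_band:
  "zariski_closed n {A \<in> carrier (GL n). band n d A \<and> band n c (adj_mat A)}"
proof -
  \<comment> \<open>The adjugate entry as an explicit minor of fixed size n - 1, so that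
    \<open>regular_det\<close> applies.\<close>
  define adj where "adj i j A = (-1) ^ (j + i) * det (mat (n - 1) (n - 1) (\<lambda>(i', j').
    A $$ (if i' < j then i' else Suc i', if j' < i then j' else Suc j')))" for i j and A :: "complex mat"
  define F where "F = (\<lambda>(i, j) A. A $$ (i, j)) ` {(i, j). i < n \<and> j < n \<and> i + d < j} \<union>
    (\<lambda>(i, j). adj i j) ` {(i, j). i < n \<and> j < n \<and> i + c < j}"
  have adj_reg: "adj i j \<in> regular_functions n" if "i < n" "j < n" for i j
    unfolding adj_def by (intro reg_mult reg_const regular_det reg_entry) (use that in auto)
  have adj: "adj_mat A $$ (i, j) = adj i j A" if "A \<in> carrier_mat n n" "i < n" "j < n" for A i j
    using that by (simp add: adj_mat_def cofactor_def mat_delete_def adj_def)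
  have "{A \<in> carrier (GL n). band n d A \<and> band n c (adj_mat A)} =
    {A \<in> carrier (GL n). \<forall>f\<in>F. f A = 0}"
  proof (rule Collect_cong, rule conj_cong[OF refl])
    fix A assume "A \<in> carrier (GL n)"
    then have A: "A \<in> carrier_mat n n" by (simp add: GL_simps)
    have "band n d A \<longleftrightarrow> (\<forall>i j. i < n \<and> j < n \<and> i + d < j \<longrightarrow> A $$ (i, j) = 0)"
      using A by (auto simp: band_def)
    moreover have "band n c (adj_mat A) \<longleftrightarrow> (\<forall>i j. i < n \<and> j < n \<and> i + c < j \<longrightarrow> adj i j A = 0)"
      using adj_mat(1)[OF A] adj[OF A] by (auto simp: band_def)
    ultimately show "(band n d A \<and> band n c (adj_mat A)) = (\<forall>f\<in>F. f A = 0)"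
      unfolding F_def ball_Un by auto
  qed
  moreover have "F \<subseteq> regular_functions n"
    using adj_reg by (auto simp: F_def intro: reg_entry)
  ultimately show ?thesis unfolding zariski_closed_def by blast
qed

lemma adj_mat_eq_inverse:
  fixes A B :: "complex mat"
  assumes A: "A \<in> carrier_mat n n" and B: "B \<in> carrier_mat n n" and AB: "A * B = 1\<^sub>m n"
  shows "adj_mat A = det A \<cdot>\<^sub>m B"
proof -
  have "adj_mat A = adj_mat A * (A * B)" using adj_mat(1)[OF A] AB by simp
  also have "\<dots> = (adj_mat A * A) * B"
    by (rule assoc_mult_mat[symmetric]) (use adj_mat(1)[OF A] A B in auto)
  also have "\<dots> = det A \<cdot>\<^sub>m B" using adj_mat(3)[OF A] B mult_smult_assoc_mat[of "1\<^sub>m n" n n B n "det A"] by simp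
  finally show ?thesis .
qed

text \<open>The permutation has bandwidth d and its inverse bandwidth c, and triangular factors
  change neither. The adjugate is a scalar multiple of the inverse.\<close>

lemma double_coset_band:
  assumes "A \<in> double_coset (d + c) (grassmann_perm d c)"
  shows "A \<in> carrier (GL (d + c))" "band (d + c) d A" "band (d + c) c (adj_mat A)"
proof -
  let ?n = "d + c" and ?w = "grassmann_perm d c" and ?w' = "grassmann_perm c d"
  from assms obtain a b where ab: "a \<in> lower_borel ?n" "b \<in> lower_borel ?n" "A = a * ?w * b"
    by (auto simp: double_coset_def)
  obtain a' where a': "a' \<in> lower_borel ?n" "a * a' = 1\<^sub>m ?n" using lower_borel_inverse[OF ab(1)] by blast
  obtain b' where b': "b' \<in> lower_borel ?n" "b * b' = 1\<^sub>m ?n" using lower_borel_inverse[OF ab(2)] by blast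
  have w': "?w' \<in> carrier_mat ?n ?n" "band ?n c ?w'"
    using grassmann_perm_carrier[of c d] grassmann_perm_band[of c d] by (simp_all add: add.commute)
  have c: "a \<in> carrier_mat ?n ?n" "b \<in> carrier_mat ?n ?n" "a' \<in> carrier_mat ?n ?n" "b' \<in> carrier_mat ?n ?n"
    using ab a' b' by (auto simp: lower_borel_band band_def)
  note cc = c w'(1) grassmann_perm_carrier[of d c]
  define B where "B = b' * ?w' * a'"
  have cA: "A \<in> carrier_mat ?n ?n" and cB: "B \<in> carrier_mat ?n ?n"
    using cc by (auto simp: ab B_def)
  have "A * B = a * (?w * ((b * b') * (?w' * a')))"
    using cc by (simp add: ab(3) B_def assoc_mult_mat[of _ ?n ?n _ ?n _ ?n] mult_carrier_mat[of _ ?n ?n _ ?n])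
  also have "\<dots> = a * ((?w * ?w') * a')"
    using cc b'(2) by (simp add: assoc_mult_mat[of _ ?n ?n _ ?n _ ?n] mult_carrier_mat[of _ ?n ?n _ ?n])
  also have "\<dots> = 1\<^sub>m ?n" using cc a'(2) by (simp add: grassmann_perm_inverse)
  finally have AB: "A * B = 1\<^sub>m ?n" .
  show "A \<in> carrier (GL ?n)" by (rule GL_inv_unique(1)[OF cA cB AB])
  show "band ?n d A"
    using band_mult[OF band_mult[of ?n 0 a d ?w] , of 0 b] ab grassmann_perm_band
    by (simp add: lower_borel_band)
  have "band ?n c B"
    using band_mult[OF band_mult[of ?n 0 b' c ?w'], of 0 a'] a' b' w'
    by (simp add: lower_borel_band B_def)
  then show "band ?n c (adj_mat A)"
    using cB by (auto simp: adj_mat_eq_inverse[OF cA cB AB] band_def)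
qed

text \<open>Let a and b be the top nonzero degrees of the series up to d and of its inverse up to c.
  If 0 < a + b < d + c, the coefficient of their product 1 in degree a + b would be the nonzero
  product of the two top coefficients.\<close>

lemma relation_locus_cases:
  fixes x :: "nat \<Rightarrow> complex"
  assumes x: "x \<in> relation_locus d c"
  defines "X \<equiv> trunc_seq d x"
  shows "(X d \<noteq> 0 \<and> inv_series X c \<noteq> 0) \<or> (\<forall>i\<ge>1. X i = 0)"
proof -
  define a where "a = Max {i. i \<le> d \<and> X i \<noteq> 0}"
  define b where "b = Max {k. k \<le> c \<and> inv_series X k \<noteq> 0}"
  have fa: "finite {i. i \<le> d \<and> X i \<noteq> 0}" and na: "{i. i \<le> d \<and> X i \<noteq> 0} \<noteq> {}"
    by (auto simp: X_def intro!: exI[of _ 0])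
  have fb: "finite {k. k \<le> c \<and> inv_series X k \<noteq> 0}" and nb: "{k. k \<le> c \<and> inv_series X k \<noteq> 0} \<noteq> {}"
    by (auto intro!: exI[of _ 0])
  have a: "a \<le> d" "X a \<noteq> 0" using Max_in[OF fa na] by (auto simp: a_def)
  have b: "b \<le> c" "inv_series X b \<noteq> 0" using Max_in[OF fb nb] by (auto simp: b_def)
  have Xz: "X i = 0" if "a < i" for i
  proof (cases "i \<le> d")
    case True
    then show ?thesis using that Max_ge[OF fa, of i] by (auto simp: a_def[symmetric])
  qed (auto simp: X_def trunc_seq_def)
  have gz: "inv_series X k = 0" if "b < k" "k < d + c" for k
  proof (cases "k \<le> c")
    case True
    then show ?thesis using that Max_ge[OF fb, of k] by (auto simp: b_def[symmetric])
  next
    case False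
    then show ?thesis using x that by (auto simp: relation_locus_def X_def)
  qed
  consider "a + b = 0" | "0 < a + b" "a + b < d + c" | "a = d" "b = c"
    using a b by linarith
  then show ?thesis
  proof cases
    case 1
    then show ?thesis using Xz by auto
  next
    case 2
    have "0 = (\<Sum>i\<le>a + b. X i * inv_series X (a + b - i))"
      using inv_series_convolution[of X "a + b"] 2 by (simp add: X_def)
    also have "\<dots> = (\<Sum>i\<in>{a}. X i * inv_series X (a + b - i))"
    proof (rule sum.mono_neutral_right)
      show "\<forall>i\<in>{..a + b} - {a}. X i * inv_series X (a + b - i) = 0"
      proof
        fix i assume i: "i \<in> {..a + b} - {a}"
        show "X i * inv_series X (a + b - i) = 0"
          using Xz[of i] gz[of "a + b - i"] i 2 by (cases "a < i") auto
      qed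
    qed auto
    finally show ?thesis using a b by simp
  next
    case 3
    then show ?thesis using a b by auto
  qed
qed

text \<open>The factorization is A T = w B, where A consists of rows of the identity followed by rows of
  the inverse of T, and B of rows of the identity followed by rows of T.\<close>

lemma toeplitz_in_double_coset:
  fixes x :: "nat \<Rightarrow> complex"
  assumes x: "x \<in> relation_locus d c"
    and X: "trunc_seq d x d \<noteq> 0" and g: "inv_series (trunc_seq d x) c \<noteq> 0"
  shows "toeplitz (d + c) (trunc_seq d x) \<in> double_coset (d + c) (grassmann_perm d c)"
proof -
  let ?n = "d + c"
  define y where "y = trunc_seq d x"
  define h where "h = inv_series y"
  have y0: "y 0 = 1" by (simp add: y_def)
  let ?T = "toeplitz ?n y" and ?w = "grassmann_perm d c"
  define A where "A = mat ?n ?n (\<lambda>(i, j). if i < c then if i = j then 1 else 0 else toeplitz ?n h $$ (i - c, j))"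
  define B where "B = mat ?n ?n (\<lambda>(i, j). if i < d then if i = j then 1 else 0 else ?T $$ (i - d, j))"
  have cA: "A \<in> carrier_mat ?n ?n" and cB: "B \<in> carrier_mat ?n ?n" by (auto simp: A_def B_def)
  have h0: "h k = 0" if "c < k" "k < ?n" for k
    using x that by (auto simp: relation_locus_def h_def y_def)
  have y_high: "y k = 0" if "d < k" for k
    using that by (simp add: y_def trunc_seq_def)
  \<comment> \<open>In row i >= c the entry in column j is h at j - i + c, which is beyond c for j >
    i and equals h c on the diagonal. B works in the same way with y and d.\<close>
  have A: "A \<in> lower_borel ?n"
  proof (rule lower_borelI)
    show "band ?n 0 A"
      using cA h0 by (auto simp: band_def A_def toeplitz_index)
    show "A $$ (i, i) \<noteq> 0" if "i < ?n" for i
      using that g by (auto simp: A_def toeplitz_index h_def y_def)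
  qed
  have B: "B \<in> lower_borel ?n"
  proof (rule lower_borelI)
    show "band ?n 0 B"
      using cB y_high by (auto simp: band_def B_def toeplitz_index)
    show "B $$ (i, i) \<noteq> 0" if "i < ?n" for i
      using that X by (auto simp: B_def toeplitz_index y_def)
  qed
  have "A * ?T = ?w * B"
  proof (rule eq_matI)
    fix i j assume "i < dim_row (?w * B)" "j < dim_col (?w * B)"
    then have ij: "i < ?n" "j < ?n" using cB grassmann_perm_carrier[of d c] by auto
    \<comment> \<open>The preimage of i under the permutation: left multiplication by
      \<open>?w\<close> puts row \<open>?r\<close> of B into row i.\<close>
    let ?r = "if i < c then i + d else i - c"
    have "(?w * B) $$ (i, j) = (\<Sum>k<?n. ?w $$ (i, k) * B $$ (k, j))"
      by (rule mat_mult_index) (use ij cB in auto)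
    also have "\<dots> = (\<Sum>k<?n. if k = ?r then B $$ (?r, j) else 0)"
      using ij by (intro sum.cong refl) (auto simp: grassmann_perm_def perm_mat_index)
    also have "\<dots> = B $$ (?r, j)" using ij by auto
    finally have R: "(?w * B) $$ (i, j) = B $$ (?r, j)" .
    have L: "(A * ?T) $$ (i, j) = (\<Sum>k<?n. A $$ (i, k) * ?T $$ (k, j))"
      by (rule mat_mult_index) (use ij cA in auto)
    show "(A * ?T) $$ (i, j) = (?w * B) $$ (i, j)"
    proof (cases "i < c")
      case True
      then have "(\<Sum>k<?n. A $$ (i, k) * ?T $$ (k, j)) = (\<Sum>k<?n. if k = i then ?T $$ (i, j) else 0)"
        using ij by (intro sum.cong) (auto simp: A_def)
      also have "\<dots> = ?T $$ (i, j)" using ij by simp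
      finally show ?thesis using L R True ij by (simp add: B_def)
    next
      case False
      then have "(\<Sum>k<?n. A $$ (i, k) * ?T $$ (k, j)) = (\<Sum>k<?n. toeplitz ?n h $$ (i - c, k) * ?T $$ (k, j))"
        using ij by (intro sum.cong) (auto simp: A_def)
      also have "\<dots> = (toeplitz ?n h * ?T) $$ (i - c, j)"
        by (rule mat_mult_index[symmetric]) (use ij in auto)
      also have "\<dots> = (if i - c = j then 1 else 0)"
        using toeplitz_inverse(2)[where x = y, OF y0, of ?n] ij by (simp add: h_def)
      finally show ?thesis using L R False ij by (simp add: B_def)
    qed
  qed (use cA cB grassmann_perm_carrier[of d c] toeplitz_carrier[of ?n y] in \<open>auto simp del: grassmann_perm_carrier toeplitz_carrier\<close>)
  moreover obtain A' where A': "A' \<in> lower_borel ?n" "A' * A = 1\<^sub>m ?n"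
    using lower_borel_inverse[OF A] by blast
  have cA': "A' \<in> carrier_mat ?n ?n" using A' by (simp add: lower_borel_band band_def)
  ultimately have "A' * ?w * B = (A' * A) * ?T"
    using cA cB by (simp add: assoc_mult_mat[of _ ?n ?n _ ?n _ ?n] mult_carrier_mat[of _ ?n ?n _ ?n])
  also have "\<dots> = ?T" unfolding A'(2) by (rule left_mult_one_mat[of _ _ ?n]) simp
  finally have "?T = A' * ?w * B" by (rule sym)
  then show ?thesis
    unfolding double_coset_def y_def[symmetric] using A'(1) B by blast
qed

text \<open>Weighted homogeneity, from the substitution of r t for t; hence the scaling action
  preserves \<open>relation_locus\<close>.\<close>

lemma inv_series_scale:
  "inv_series (trunc_seq d (\<lambda>i. r ^ i * x i)) k = r ^ k * inv_series (trunc_seq d x) k"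
proof (induction k rule: less_induct)
  case (less k)
  show ?case
  proof (cases "k = 0")
    case False
    have "trunc_seq d (\<lambda>i. r ^ i * x i) i * inv_series (trunc_seq d (\<lambda>i. r ^ i * x i)) (k - i) =
        r ^ k * (trunc_seq d x i * inv_series (trunc_seq d x) (k - i))" if "i \<in> {1..k}" for i
    proof -
      have "r ^ k = r ^ i * r ^ (k - i)" using that by (simp flip: power_add)
      moreover have "trunc_seq d (\<lambda>i. r ^ i * x i) i = r ^ i * trunc_seq d x i"
        by (simp add: trunc_seq_def)
      ultimately show ?thesis using less[of "k - i"] that by simp
    qed
    then show ?thesis
      using False by (simp add: inv_series.simps[of _ k] sum_distrib_left)
  qed simp
qed

text \<open>The determinant is constantly 1 along the family, so its inverse causes no pole.\<close>

lemma isCont_regular_toeplitz: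
  "f \<in> regular_functions n \<Longrightarrow>
    isCont (\<lambda>r::complex. f (toeplitz n (trunc_seq d (\<lambda>i. r ^ i * x i)))) s"
proof (induction rule: regular_functions.induct)
  case (reg_entry i j)
  then show ?case
    by (cases "i = j"; cases "i \<le> j"; cases "j - i \<le> d") (simp_all add: toeplitz_index trunc_seq_def)
next
  case reg_inv_det
  then show ?case by (simp add: det_toeplitz)
qed auto

text \<open>The identity matrix is the limit of a torus orbit in the open cell.\<close>

lemma toeplitz_in_closure:
  fixes x :: "nat \<Rightarrow> complex"
  assumes x: "x \<in> relation_locus d c" and d: "1 \<le> d"
  shows "toeplitz (d + c) (trunc_seq d x) \<in>
    zariski_closure (d + c) (double_coset (d + c) (grassmann_perm d c))"
  unfolding zariski_closure_def
proof (rule InterI, clarify)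
  let ?n = "d + c" and ?D = "double_coset (d + c) (grassmann_perm d c)"
  fix Z assume "zariski_closed ?n Z" and sub: "?D \<subseteq> Z"
  then obtain F where F: "F \<subseteq> regular_functions ?n" "Z = {A \<in> carrier (GL ?n). \<forall>f\<in>F. f A = 0}"
    by (auto simp: zariski_closed_def)
  consider "trunc_seq d x d \<noteq> 0" "inv_series (trunc_seq d x) c \<noteq> 0" | "\<forall>i\<ge>1. trunc_seq d x i = 0"
    using relation_locus_cases[OF x] by blast
  then show "toeplitz ?n (trunc_seq d x) \<in> Z"
  proof cases
    case 1
    then show ?thesis using toeplitz_in_double_coset[OF x] sub by blast
  next
    case 2
    obtain z where z: "z \<in> relation_locus d c" "z d \<noteq> 0"
    proof -
      obtain P where P: "card P = (d + c) choose d" "P \<subseteq> relation_locus d c" "\<forall>x\<in>P. x d \<noteq> 0"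
        using fibre_points[of 1 d c] d by auto
      have "(d + c) choose d > 0" by simp
      then have "P \<noteq> {}" using P(1) by auto
      then show ?thesis using that P by blast
    qed
    define T where "T r = toeplitz ?n (trunc_seq d (\<lambda>i. r ^ i * z i))" for r :: complex
    have T0: "T 0 = toeplitz ?n (trunc_seq d x)"
      unfolding T_def
      by (rule arg_cong[of _ _ "toeplitz ?n"]) (use 2 in \<open>auto simp: trunc_seq_def fun_eq_iff\<close>)
    have Tr: "T r \<in> ?D" if r: "r \<noteq> 0" for r
    proof -
      have l: "(\<lambda>i. r ^ i * z i) \<in> relation_locus d c"
        using z(1) by (auto simp: relation_locus_def inv_series_scale)
      \<comment> \<open>A nonzero d-th coordinate excludes the trivial alternative of
        \<open>relation_locus_cases\<close>, so the scaled point lies in the open cell.\<close>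
      have "trunc_seq d (\<lambda>i. r ^ i * z i) d \<noteq> 0" using z r d by (auto simp: trunc_seq_def)
      with relation_locus_cases[OF l] d show ?thesis
        unfolding T_def by (intro toeplitz_in_double_coset[OF l]) auto
    qed
    \<comment> \<open>A defining equation of Z holds for all r \<noteq> 0, hence at r = 0 by
      continuity in the usual topology.\<close>
    have "f (T 0) = 0" if f: "f \<in> F" for f
    proof -
      have "(\<lambda>r. f (T r)) \<midarrow>0\<rightarrow> f (T 0)"
        using isCont_regular_toeplitz[where f = f and n = ?n and d = d and x = z and s = 0] f F(1) by (auto simp: isCont_def T_def)
      moreover have "(\<lambda>r. f (T r)) \<midarrow>0\<rightarrow> 0"
      proof (rule tendsto_eventually)
        show "\<forall>\<^sub>F r in at 0. f (T r) = 0"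
          unfolding eventually_at_filter using Tr sub F(2) f by (intro always_eventually) auto
      qed
      ultimately show ?thesis by (rule LIM_unique)
    qed
    moreover have "T 0 \<in> carrier (GL ?n)" unfolding T_def by (rule toeplitz_GL) simp
    ultimately show ?thesis using F(2) T0 by auto
  qed
qed

lemma peterson_variety_eq:
  assumes d: "1 \<le> d"
  shows "peterson_variety d (d + c) = (\<lambda>x. toeplitz (d + c) (trunc_seq d x)) ` relation_locus d c"
proof -
  let ?n = "d + c"
  have w: "w_upper ?n ({1..?n - 1} - {d}) = grassmann_perm d c"
    using w_upper_maximal_parabolic[of d ?n] by (simp only: grassmann_perm_def diff_add_inverse le_add1)
  show ?thesis
  proof (intro equalityI subsetI)
    fix u assume "u \<in> peterson_variety d ?n"
    then have uc: "u \<in> upper_unipotent_centralizer ?n"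
      and ucl: "u \<in> zariski_closure ?n (double_coset ?n (grassmann_perm d c))"
      by (simp_all only: peterson_variety_def w Int_iff)
    obtain x where x: "x 0 = 1" "u = toeplitz ?n x" using uc by (auto simp: upper_unipotent_centralizer_eq)
    have "u \<in> {A \<in> carrier (GL ?n). band ?n d A \<and> band ?n c (adj_mat A)}"
      using ucl zariski_closed_band[of ?n d c] double_coset_band[of _ d c]
      unfolding zariski_closure_def by blast
    then have u: "band ?n d u" "band ?n c (adj_mat u)" by auto
    \<comment> \<open>The first row already shows all the coordinates, so the band conditions are
      read off there, for u and for its adjugate.\<close>
    have xz: "x k = 0" if "d < k" "k < ?n" for k
    proof -
      have "u $$ (0, k) = 0" using u(1) that unfolding band_def by force
      then show ?thesis using that by (simp add: x(2) toeplitz_index)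
    qed
    then have u_eq: "u = toeplitz ?n (trunc_seq d x)"
      unfolding x(2) by (intro eq_matI) (use x(1) in \<open>auto simp: toeplitz_def trunc_seq_def\<close>)
    \<comment> \<open>The determinant is 1, so the adjugate is the inverse, again a Toeplitz
      matrix.\<close>
    have adj: "adj_mat u = toeplitz ?n (inv_series (trunc_seq d x))"
      using adj_mat_eq_inverse[OF _ _ toeplitz_inverse(1)[of "trunc_seq d x" ?n]]
        det_toeplitz[of "trunc_seq d x" ?n] by (simp add: u_eq) (auto intro!: eq_matI)
    have "inv_series (trunc_seq d x) k = 0" if "c < k" "k < ?n" for k
    proof -
      have "adj_mat u $$ (0, k) = 0" using u(2) that unfolding band_def by force
      then show ?thesis using that by (simp add: adj toeplitz_index)
    qed
    then have "x \<in> relation_locus d c" by (simp add: relation_locus_def)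
    then show "u \<in> (\<lambda>x. toeplitz ?n (trunc_seq d x)) ` relation_locus d c"
      using u_eq by blast
  next
    fix u assume "u \<in> (\<lambda>x. toeplitz ?n (trunc_seq d x)) ` relation_locus d c"
    then obtain x where x: "x \<in> relation_locus d c" "u = toeplitz ?n (trunc_seq d x)" by blast
    then have "u \<in> upper_unipotent_centralizer ?n"
      by (auto simp: upper_unipotent_centralizer_eq intro!: exI[of _ "trunc_seq d x"])
    then show "u \<in> peterson_variety d ?n"
      using toeplitz_in_closure[OF x(1) d] x(2) by (simp only: peterson_variety_def w Int_iff)
  qed
qed

section \<open>The coordinate ring\<close>

lemma polynomial_ring_simps [simp]:
  "x \<otimes>\<^bsub>polynomial_ring d\<^esub> y = x * y" "x \<oplus>\<^bsub>polynomial_ring d\<^esub> y = x + y"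
  "\<one>\<^bsub>polynomial_ring d\<^esub> = 1" "\<zero>\<^bsub>polynomial_ring d\<^esub> = 0"
  by (simp_all add: polynomial_ring_def)

lemma ring_polynomial_ring: "ring (polynomial_ring d)"
proof (rule ringI)
  show "abelian_group (polynomial_ring d)"
  proof (rule abelian_groupI)
    fix p assume "p \<in> polys d"
    then show "\<exists>q\<in>polys d. q \<oplus>\<^bsub>polynomial_ring d\<^esub> p = \<zero>\<^bsub>polynomial_ring d\<^esub>"
      by (intro bexI[of _ "- p"]) auto
  qed (auto simp: algebra_simps)
  show "monoid (polynomial_ring d)"
    by (rule monoidI) (auto simp: algebra_simps)
qed (auto simp: algebra_simps)

lemma coordinate_ring_simps:
  "carrier (coordinate_ring n V) = {restrict f V |f. f \<in> regular_functions n}"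
  "f \<otimes>\<^bsub>coordinate_ring n V\<^esub> g = (\<lambda>A\<in>V. f A * g A)"
  "f \<oplus>\<^bsub>coordinate_ring n V\<^esub> g = (\<lambda>A\<in>V. f A + g A)"
  "\<one>\<^bsub>coordinate_ring n V\<^esub> = (\<lambda>A\<in>V. 1)" "\<zero>\<^bsub>coordinate_ring n V\<^esub> = (\<lambda>A\<in>V. 0)"
  by (simp_all add: coordinate_ring_def)

lemma ring_coordinate_ring: "ring (coordinate_ring n V)"
proof -
  let ?S = "coordinate_ring n V"
  have carrierI: "(\<lambda>A\<in>V. f A) \<in> carrier ?S" if "f \<in> regular_functions n" for f
    using that by (auto simp: coordinate_ring_simps)
  have carrierE: "\<exists>f\<in>regular_functions n. x = restrict f V" if "x \<in> carrier ?S" for x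
    using that by (auto simp: coordinate_ring_simps)
  have add: "x \<oplus>\<^bsub>?S\<^esub> y \<in> carrier ?S" if xy: "x \<in> carrier ?S" "y \<in> carrier ?S" for x y
  proof -
    obtain f g where "f \<in> regular_functions n" "g \<in> regular_functions n" "x = restrict f V" "y = restrict g V"
      using carrierE[OF xy(1)] carrierE[OF xy(2)] by blast
    then have "x \<oplus>\<^bsub>?S\<^esub> y = (\<lambda>A\<in>V. f A + g A)" "(\<lambda>A. f A + g A) \<in> regular_functions n"
      by (auto simp: coordinate_ring_simps restrict_def intro: reg_add)
    then show ?thesis using carrierI by metis
  qed
  have mult: "x \<otimes>\<^bsub>?S\<^esub> y \<in> carrier ?S" if xy: "x \<in> carrier ?S" "y \<in> carrier ?S" for x y
  proof -
    obtain f g where "f \<in> regular_functions n" "g \<in> regular_functions n" "x = restrict f V" "y = restrict g V"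
      using carrierE[OF xy(1)] carrierE[OF xy(2)] by blast
    then have "x \<otimes>\<^bsub>?S\<^esub> y = (\<lambda>A\<in>V. f A * g A)" "(\<lambda>A. f A * g A) \<in> regular_functions n"
      by (auto simp: coordinate_ring_simps restrict_def intro: reg_mult)
    then show ?thesis using carrierI by metis
  qed
  have ext: "(\<lambda>A\<in>V. x A) = x" if "x \<in> carrier ?S" for x
    using carrierE[OF that] by auto
  have neg: "\<exists>y\<in>carrier ?S. y \<oplus>\<^bsub>?S\<^esub> x = \<zero>\<^bsub>?S\<^esub>" if x: "x \<in> carrier ?S" for x
  proof -
    obtain f where f: "f \<in> regular_functions n" "x = restrict f V" using carrierE[OF x] by blast
    have "(\<lambda>A. (-1) * f A) \<in> regular_functions n" by (intro reg_mult reg_const f)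
    from carrierI[OF this] show ?thesis
      using f by (intro bexI[of _ "\<lambda>A\<in>V. (-1) * f A"]) (auto simp: coordinate_ring_simps restrict_def)
  qed
  have one: "\<one>\<^bsub>?S\<^esub> \<in> carrier ?S" and zero: "\<zero>\<^bsub>?S\<^esub> \<in> carrier ?S"
    using carrierI[OF reg_const[of 1]] carrierI[OF reg_const[of 0]] by (simp_all only: coordinate_ring_simps)
  show ?thesis
  proof (rule ringI)
    show "abelian_group ?S"
    proof (rule abelian_groupI)
      fix x assume "x \<in> carrier ?S"
      then show "\<zero>\<^bsub>?S\<^esub> \<oplus>\<^bsub>?S\<^esub> x = x"
        using ext[of x] by (simp add: coordinate_ring_simps(3,5) restrict_def cong: if_cong)
    qed (use add zero neg in \<open>auto simp: coordinate_ring_simps(3) restrict_def algebra_simps\<close>)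
    show "monoid ?S"
    proof (rule monoidI)
      fix x assume "x \<in> carrier ?S"
      then show "\<one>\<^bsub>?S\<^esub> \<otimes>\<^bsub>?S\<^esub> x = x" "x \<otimes>\<^bsub>?S\<^esub> \<one>\<^bsub>?S\<^esub> = x"
        using ext[of x] by (simp_all add: coordinate_ring_simps(2,4) restrict_def cong: if_cong)
    qed (use mult one in \<open>auto simp: coordinate_ring_simps(2) restrict_def algebra_simps\<close>)
  qed (auto simp: coordinate_ring_simps(2,3) restrict_def algebra_simps)
qed

text \<open>Entries become variables or constants and the inverse determinant becomes 1; this yields
  surjectivity of the evaluation map.\<close>

lemma regular_on_toeplitz:
  "f \<in> regular_functions n \<Longrightarrow>
    \<exists>p\<in>polys d. \<forall>x. f (toeplitz n (trunc_seq d x)) = cpoly_eval x p"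
proof (induction rule: regular_functions.induct)
  case (reg_const a)
  show ?case by (intro bexI[of _ "poly_const a"]) auto
next
  case (reg_entry i j)
  show ?case
  proof (cases "i < j \<and> j - i \<le> d")
    case True
    then show ?thesis
      using reg_entry by (intro bexI[of _ "poly_var (j - i)"]) (auto simp: toeplitz_index trunc_seq_def)
  next
    case False
    then show ?thesis
      using reg_entry
      by (intro bexI[of _ "poly_const (if i = j then 1 else 0)"]) (auto simp: toeplitz_index trunc_seq_def)
  qed
next
  case reg_inv_det
  show ?case by (intro bexI[of _ 1]) (auto simp: det_toeplitz)
next
  case (reg_add f g)
  then obtain p q where "p \<in> polys d" "q \<in> polys d"
    "\<forall>x. f (toeplitz n (trunc_seq d x)) = cpoly_eval x p"
    "\<forall>x. g (toeplitz n (trunc_seq d x)) = cpoly_eval x q" by blast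
  then show ?case by (intro bexI[of _ "p + q"]) auto
next
  case (reg_mult f g)
  then obtain p q where "p \<in> polys d" "q \<in> polys d"
    "\<forall>x. f (toeplitz n (trunc_seq d x)) = cpoly_eval x p"
    "\<forall>x. g (toeplitz n (trunc_seq d x)) = cpoly_eval x q" by blast
  then show ?case by (intro bexI[of _ "p * q"]) auto
qed

lemma regular_cpoly_eval:
  assumes "d < n" "p \<in> polys d"
  shows "(\<lambda>u. cpoly_eval (\<lambda>j. toeplitz_coord j u) p) \<in> regular_functions n"
  using assms(2)
proof (induction rule: polys_induct)
  case (var i p)
  have "(\<lambda>u. u $$ (0, i) * cpoly_eval (\<lambda>j. toeplitz_coord j u) p) \<in> regular_functions n"
    by (rule reg_mult[OF reg_entry]) (use var assms(1) in auto)
  then show ?case by (simp add: toeplitz_coord_def)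
qed (auto intro: regular_functions.intros)

theorem theorem3p4:
  fixes n d :: nat
  assumes "n \<ge> 2" and "1 \<le> d" and "d \<le> n - 1"
  shows "\<exists>\<phi> \<in> ring_iso (Lambda d n) (coordinate_ring n (peterson_variety d n)).
    (\<forall>a. \<phi> (Lambda_class d n (poly_const a)) = (\<lambda>u\<in>peterson_variety d n. a)) \<and>
    (\<forall>j\<in>{1..d}. \<phi> (Lambda_class d n (poly_var j)) =
      restrict (toeplitz_coord j) (peterson_variety d n))"
proof -
  define c where "c = n - d"
  have n: "n = d + c" and c: "1 \<le> c" using assms by (auto simp: c_def)
  let ?V = "peterson_variety d n" and ?R = "polynomial_ring d"
  let ?S = "coordinate_ring n ?V"
  let ?T = "\<lambda>x. toeplitz n (trunc_seq d x)"
  define h where "h p = (\<lambda>u\<in>?V. cpoly_eval (\<lambda>j. toeplitz_coord j u) p)" for p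
  have V: "?V = ?T ` relation_locus d c"
    unfolding n by (rule peterson_variety_eq[OF assms(2)])
  have eval: "cpoly_eval (\<lambda>j. toeplitz_coord j (?T x)) p = cpoly_eval x p" if "p \<in> polys d" for p x
    by (rule cpoly_eval_cong[OF that]) (use n c in \<open>auto simp: toeplitz_coord_def toeplitz_index trunc_seq_def\<close>)
  interpret R: ring ?R by (rule ring_polynomial_ring)
  have h_carrier: "h p \<in> carrier ?S" if "p \<in> polys d" for p
    unfolding h_def coordinate_ring_simps using regular_cpoly_eval[OF _ that, of n] n c by auto
  have "h \<in> Ring.ring_hom ?R ?S"
    by (rule ring_hom_memI) (use h_carrier in \<open>auto simp: h_def coordinate_ring_simps(2-5) restrict_def\<close>)
  then interpret h: ring_hom_ring ?R ?S h
    by (intro ring_hom_ringI2 ring_polynomial_ring ring_coordinate_ring)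
  \<comment> \<open>On the parametrized variety, being the zero function means vanishing on
    \<open>relation_locus\<close>.\<close>
  have ker: "p \<in> a_kernel ?R ?S h \<longleftrightarrow> p \<in> polys d \<and> (\<forall>x\<in>relation_locus d c. cpoly_eval x p = 0)" for p
  proof -
    have "h p = \<zero>\<^bsub>?S\<^esub> \<longleftrightarrow> (\<forall>u\<in>?V. cpoly_eval (\<lambda>j. toeplitz_coord j u) p = 0)"
    proof
      assume eq: "h p = \<zero>\<^bsub>?S\<^esub>"
      show "\<forall>u\<in>?V. cpoly_eval (\<lambda>j. toeplitz_coord j u) p = 0"
      proof
        fix u assume "u \<in> ?V"
        then show "cpoly_eval (\<lambda>j. toeplitz_coord j u) p = 0"
          using fun_cong[OF eq, of u] by (simp add: h_def coordinate_ring_simps(5))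
      qed
    next
      assume "\<forall>u\<in>?V. cpoly_eval (\<lambda>j. toeplitz_coord j u) p = 0"
      then show "h p = \<zero>\<^bsub>?S\<^esub>"
        unfolding h_def coordinate_ring_simps(5) by (intro restrict_ext) simp
    qed
    also have "\<dots> \<longleftrightarrow> (\<forall>x\<in>relation_locus d c. cpoly_eval (\<lambda>j. toeplitz_coord j (?T x)) p = 0)"
      unfolding V by (rule ball_simps)
    finally show ?thesis
      unfolding a_kernel_def' using eval[of p] by (cases "p \<in> polys d") simp_all
  qed
  let ?Y = "Y_poly d ` {n - d + 1..n - 1}"
  have Y_polys: "?Y \<subseteq> polys d"
  proof -
    have "Y_poly d k \<in> polys d" for k
      by (cases "even k") (simp_all add: Y_poly_eq)
    then show ?thesis by blast
  qed
  have Lam: "ideal (Lambda_ideal d n) ?R"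
    unfolding Lambda_ideal_def by (rule R.genideal_ideal[OF Y_polys])
  interpret I: ideal "Lambda_ideal d n" ?R by (rule Lam)
  have ker_sup: "Lambda_ideal d n \<subseteq> a_kernel ?R ?S h"
    unfolding Lambda_ideal_def
  proof (rule R.genideal_minimal[OF h.kernel_is_ideal], rule subsetI)
    fix y assume y: "y \<in> ?Y"
    then obtain k where "k \<in> {n - d + 1..n - 1}" and y_eq: "y = Y_poly d k" by blast
    then have k: "c < k" "k < d + c" using n c by auto
    have "cpoly_eval x y = 0" if "x \<in> relation_locus d c" for x
      using that k unfolding y_eq Y_poly_eq by (cases "even k") (auto simp: relation_locus_def)
    then show "y \<in> a_kernel ?R ?S h" using y Y_polys ker by blast
  qed
  \<comment> \<open>Here radicality enters: a polynomial vanishing on the locus lies in the ideal of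
    the relations.\<close>
  have ker_sub: "p \<in> Lambda_ideal d n" if p: "p \<in> a_kernel ?R ?S h" for p
  proof (rule vanishing_ideal_relations[where d = d and c = c])
    show "0 \<in> Lambda_ideal d n" using I.zero_closed by simp
    show "p + q \<in> Lambda_ideal d n" if "p \<in> Lambda_ideal d n" "q \<in> Lambda_ideal d n" for p q
      using I.a_closed[OF that] by simp
    show mult: "p * q \<in> Lambda_ideal d n" if "p \<in> polys d" "q \<in> Lambda_ideal d n" for p q
      using I.I_l_closed[OF that(2,1)] by simp
    show "inv_poly d k \<in> Lambda_ideal d n" if k: "c < k" "k < d + c" for k
    proof -
      have "Y_poly d k \<in> ?Y" using k n by (intro imageI) auto
      then have "Y_poly d k \<in> Lambda_ideal d n"
        using R.genideal_self[OF Y_polys] unfolding Lambda_ideal_def by blast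
      \<comment> \<open>The sign between \<open>Y_poly\<close> and \<open>inv_poly\<close> is a
        unit, so both generate the same ideal.\<close>
      then have "poly_const ((-1) ^ k) * Y_poly d k \<in> Lambda_ideal d n" by (intro mult) auto
      moreover have "poly_const ((-1) ^ k) * Y_poly d k = inv_poly d k"
        by (cases "even k") (auto simp: Y_poly_eq poly_const_uminus)
      ultimately show ?thesis by simp
    qed
    show "cpoly_eval x p = 0" if "p \<in> Lambda_ideal d n" "x \<in> relation_locus d c" for p x
      using that ker_sup ker by blast
  qed (use p ker assms in auto)
  have ker_eq: "a_kernel ?R ?S h = Lambda_ideal d n" using ker_sub ker_sup by blast
  have "carrier ?S \<subseteq> h ` polys d"
  proof
    fix y assume "y \<in> carrier ?S"
    then obtain f where f: "f \<in> regular_functions n" "y = restrict f ?V"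
      by (auto simp: coordinate_ring_simps)
    obtain p where p: "p \<in> polys d" "\<forall>x. f (?T x) = cpoly_eval x p"
      using regular_on_toeplitz[OF f(1)] by blast
    have "y = h p"
      unfolding f(2) h_def V by (rule restrict_ext) (use p eval in auto)
    then show "y \<in> h ` polys d" using p by blast
  qed
  then have surj: "h ` carrier ?R = carrier ?S" using h_carrier by blast
  let ?\<phi> = "\<lambda>X. the_elem (h ` X)"
  \<comment> \<open>\<open>h\<close> is constant on cosets of its kernel, so the image of a coset is
    a singleton and \<open>the_elem\<close> returns the induced value.\<close>
  have iso: "?\<phi> \<in> ring_iso (Lambda d n) ?S"
    using h.FactRing_iso_set[OF surj] by (simp add: Lambda_def ker_eq)
  have \<phi>: "?\<phi> (Lambda_class d n p) = h p" if p: "p \<in> polys d" for p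
    unfolding Lambda_class_def ker_eq[symmetric] using h.the_elem_simp p by simp
  show ?thesis
  proof (rule bexI[OF _ iso], intro conjI allI ballI)
    show "?\<phi> (Lambda_class d n (poly_const a)) = (\<lambda>u\<in>?V. a)" for a
      by (simp add: \<phi>) (simp add: h_def)
    show "?\<phi> (Lambda_class d n (poly_var j)) = restrict (toeplitz_coord j) ?V" if "j \<in> {1..d}" for j
      using that by (simp add: \<phi>) (simp add: h_def)
  qed
qed

end
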